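(* Let $G$ be a real Lie group acting continuously on a locally compact second countable metrizable space $X$, and let $E$ be a countable set with a coding map $E\to G$, $e\mapsto g_e$. Suppose a Markov chain on $E$ is irreducible and positive recurrent and let $\pi$ be its stationary distribution. If $\nu$ is a stationary probability measure for the action chain on $E\times X$, then $$\nu=\sum_{e\in E}\pi(\{e\})\,\delta_e\otimes\nu_e,$$ where for each $e\in E$, $\nu_e$ is a $\mu_e$-stationary probability measure on $X$, satisfying $$\pi(\{e\})\nu_e=\sum_{e'\in E}\pi(\{e'\})\,p_{e,e'}\,(g_{e'})_*\nu_{e'}.$$ If $\nu$ is ergodic, then the $\nu_e$ are $\mu_e$-ergodic. Furthermore, if $c\in E^*$ is $(e{\leftarrow}e')$-admissible, we have $(g_c)_*\nu_{e'}\ll\nu_e$, and if moreover $\nu_e$ is $G_e^+$-invariant, then $\nu_e$ and $(g_c)_*\nu_{e'}$ belong to the same measure class.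
   Context: Markov chain notation: $p_{e',e}$ is the probability of going from state $e$ to state $e'$, and $P(e,\cdot)$ is the transition probability distribution from $e$; $\mathbb{P}_e$ is the Markov measure on $E^{\mathbb{N}}$ (indices from $0$) started at $\omega_0=e$, with expectation $\mathbb{E}_e$; $\tau_e(\omega)=\inf\{n\ge1:\omega_n=e\}$. Irreducible: $\mathbb{P}_e[\tau_{e'}<\infty]>0$ for all $e,e'$. Positive recurrent: $\mathbb{E}_e[\tau_e]<\infty$ for all $e$. The action chain is the Markov chain on $E\times X$ with transition kernel $Q((e,x),\cdot)=P(e,\cdot)\otimes\delta_{g_ex}$. A stationary probability measure for it is ergodic if it is extremal among its stationary probability measures. The renewal measure $\mu_e$ is the law on $G$ of $g_{\omega_{\tau_e-1}}\cdots g_{\omega_0}$ under $\mathbb{P}_e$; $G_e^+$ is the closed subsemigroup of $G$ generated by $\operatorname{supp}(\mu_e)$. A probability measure $\eta$ on $X$ is $\mu_e$-stationary if $\int_Gg_*\eta\,d\mu_e(g)=\eta$, and a $\mu_e$-stationary probability measure is $\mu_e$-ergodic if it is extremal among $\mu_e$-stationary probability measures. $E^*$ is the set of finite words over $E$, written right to left: for $w=e_{n-1}\ldots e_0$, $g_w=g_{e_{n-1}}\cdots g_{e_0}$. A non-empty word $w=e_{n-1}\ldots e_0$ is $(e{\leftarrow}e')$-admissible if $e_0=e'$, $p_{e_k,e_{k-1}}>0$ for $1\le k\le n-1$, and $p_{e,e_{n-1}}>0$. *)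

theory Defs
  imports
    "HOL-Analysis.Analysis"
    "HOL-Probability.Probability"
    "HOL-Algebra.Group_Action"
begin

text \<open>
  The model space is \<^term>\<open>Euclidean_space n\<close>, that is, the set of all \<open>x :: nat \<Rightarrow> real\<close> with
  \<open>x i = 0\<close> for \<open>i \<ge> n\<close>. In contrast to the class \<^class>\<open>euclidean_space\<close> this allows \<open>n = 0\<close>,
  so that discrete groups are included.
\<close>

definition partial_deriv :: "nat \<Rightarrow> ((nat \<Rightarrow> real) \<Rightarrow> real) \<Rightarrow> (nat \<Rightarrow> real) \<Rightarrow> real" where
  "partial_deriv i f x = deriv (\<lambda>t. f (x(i := t))) (x i)"

text \<open>
  In the following definitions \<open>W\<close> is meant to be an open subset of \<^term>\<open>Euclidean_space m\<close>.
\<close>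

primrec Ck_on :: "nat \<Rightarrow> nat \<Rightarrow> (nat \<Rightarrow> real) set \<Rightarrow> ((nat \<Rightarrow> real) \<Rightarrow> real) \<Rightarrow> bool" where
  "Ck_on 0 m W f \<longleftrightarrow> continuous_map (subtopology (Euclidean_space m) W) euclideanreal f"
| "Ck_on (Suc k) m W f \<longleftrightarrow>
     continuous_map (subtopology (Euclidean_space m) W) euclideanreal f \<and>
     (\<forall>i<m. (\<forall>x\<in>W. (\<lambda>t. f (x(i := t))) differentiable (at (x i))) \<and>
            Ck_on k m W (partial_deriv i f))"

definition smooth_map_on ::
    "nat \<Rightarrow> nat \<Rightarrow> (nat \<Rightarrow> real) set \<Rightarrow> ((nat \<Rightarrow> real) \<Rightarrow> (nat \<Rightarrow> real)) \<Rightarrow> bool" where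
  "smooth_map_on m n W F \<longleftrightarrow> (\<forall>j<n. \<forall>k. Ck_on k m W (\<lambda>x. F x j))"

definition is_chart :: "'g topology \<Rightarrow> nat \<Rightarrow> 'g set \<Rightarrow> ('g \<Rightarrow> nat \<Rightarrow> real) \<Rightarrow> bool" where
  "is_chart T n U \<phi> \<longleftrightarrow>
     openin T U \<and> openin (Euclidean_space n) (\<phi> ` U) \<and>
     homeomorphic_map (subtopology T U) (subtopology (Euclidean_space n) (\<phi> ` U)) \<phi>"

definition smooth_atlas ::
    "'g topology \<Rightarrow> nat \<Rightarrow> ('g set \<times> ('g \<Rightarrow> nat \<Rightarrow> real)) set \<Rightarrow> bool" where
  "smooth_atlas T n \<A> \<longleftrightarrow>
     (\<forall>(U, \<phi>)\<in>\<A>. is_chart T n U \<phi>) \<and>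
     (\<Union>(U, \<phi>)\<in>\<A>. U) = topspace T \<and>
     (\<forall>(U, \<phi>)\<in>\<A>. \<forall>(V, \<psi>)\<in>\<A>.
        smooth_map_on n n (\<phi> ` (U \<inter> V)) (\<lambda>x. \<psi> (inv_into U \<phi> x)))"

text \<open>The two factors of \<open>\<real>\<^sup>n\<^sup>+\<^sup>n = \<real>\<^sup>n \<times> \<real>\<^sup>n\<close>.\<close>

definition proj_left :: "nat \<Rightarrow> (nat \<Rightarrow> real) \<Rightarrow> nat \<Rightarrow> real" where
  "proj_left n z = (\<lambda>i. if i < n then z i else 0)"

definition proj_right :: "nat \<Rightarrow> (nat \<Rightarrow> real) \<Rightarrow> nat \<Rightarrow> real" where
  "proj_right n z = (\<lambda>i. if i < n then z (n + i) else 0)"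

text \<open>
  As usual for manifolds, the underlying space is Hausdorff and second countable; it need not be
  connected. Continuity of the group operations, though a consequence of their smoothness as maps
  of manifolds, is listed separately so that the domains of their coordinate expressions are open.
\<close>

locale real_Lie_group = group G for G (structure) +
  fixes T :: "'a topology" and n :: nat and \<A> :: "('a set \<times> ('a \<Rightarrow> nat \<Rightarrow> real)) set"
  assumes topspace_eq: "topspace T = carrier G"
    and Hausdorff: "Hausdorff_space T"
    and second_countable: "second_countable T"
    and atlas: "smooth_atlas T n \<A>"
    and continuous_mult: "continuous_map (prod_topology T T) T (\<lambda>(a, b). a \<otimes> b)"
    and continuous_inv: "continuous_map T T (\<lambda>a. inv a)"
    and smooth_mult:
      "\<And>U \<phi> V \<psi> W \<theta>. (U, \<phi>) \<in> \<A> \<Longrightarrow> (V, \<psi>) \<in> \<A> \<Longrightarrow> (W, \<theta>) \<in> \<A> \<Longrightarrow>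
         smooth_map_on (n + n) n
           {z \<in> topspace (Euclidean_space (n + n)).
              proj_left n z \<in> \<phi> ` U \<and> proj_right n z \<in> \<psi> ` V \<and>
              inv_into U \<phi> (proj_left n z) \<otimes> inv_into V \<psi> (proj_right n z) \<in> W}
           (\<lambda>z. \<theta> (inv_into U \<phi> (proj_left n z) \<otimes> inv_into V \<psi> (proj_right n z)))"
    and smooth_inv:
      "\<And>U \<phi> V \<psi>. (U, \<phi>) \<in> \<A> \<Longrightarrow> (V, \<psi>) \<in> \<A> \<Longrightarrow>
         smooth_map_on n n {x \<in> \<phi> ` U. inv (inv_into U \<phi> x) \<in> V}
           (\<lambda>x. \<psi> (inv (inv_into U \<phi> x)))"

definition continuous_group_action ::
    "('g, 'm) monoid_scheme \<Rightarrow> 'g topology \<Rightarrow> 'x topology \<Rightarrow> ('g \<Rightarrow> 'x \<Rightarrow> 'x) \<Rightarrow> bool" where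
  "continuous_group_action G T X act \<longleftrightarrow>
     group_action G (topspace X) act \<and>
     continuous_map (prod_topology T X) X (\<lambda>(h, x). act h x)"

definition borel_of :: "'x topology \<Rightarrow> 'x measure" where
  "borel_of X = sigma (topspace X) {U. openin X U}"

definition prob_measures_on :: "'x measure \<Rightarrow> 'x measure set" where
  "prob_measures_on B = {\<eta>. prob_space \<eta> \<and> sets \<eta> = sets B}"

definition measure_support :: "'x topology \<Rightarrow> 'x measure \<Rightarrow> 'x set" where
  "measure_support X \<mu> = {x \<in> topspace X. \<forall>U. openin X U \<and> x \<in> U \<longrightarrow> emeasure \<mu> U > 0}"

definition extremal_in :: "'x measure set \<Rightarrow> 'x measure \<Rightarrow> bool" where
  "extremal_in S \<eta> \<longleftrightarrow> \<eta> \<in> S \<and>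
     (\<forall>\<eta>1\<in>S. \<forall>\<eta>2\<in>S. \<forall>t::real. 0 < t \<and> t < 1 \<and>
        (\<forall>A\<in>sets \<eta>. measure \<eta> A = t * measure \<eta>1 A + (1 - t) * measure \<eta>2 A) \<longrightarrow>
        \<eta>1 = \<eta> \<and> \<eta>2 = \<eta>)"

text \<open>
  A Markov chain is given by its kernel \<open>P :: 'e \<Rightarrow> 'e pmf\<close>; the probability \<open>p\<^bsub>e',e\<^esub>\<close> of going from
  \<open>e\<close> to \<open>e'\<close> is \<open>pmf (P e) e'\<close>. The Markov measure is the Ionescu-Tulcea limit of the one-step
  kernels; its values on cylinders are computed in \<open>emeasure_markov_measure_cylinder\<close> below.
\<close>

primrec markov_step :: "('e \<Rightarrow> 'e pmf) \<Rightarrow> 'e \<Rightarrow> nat \<Rightarrow> (nat \<Rightarrow> 'e) \<Rightarrow> 'e measure" where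
  "markov_step P e 0 \<omega> = return (count_space UNIV) e"
| "markov_step P e (Suc n) \<omega> = measure_pmf (P (\<omega> n))"

definition markov_measure :: "('e \<Rightarrow> 'e pmf) \<Rightarrow> 'e \<Rightarrow> (nat \<Rightarrow> 'e) measure" where
  "markov_measure P e =
     projective_family.lim UNIV
       (Ionescu_Tulcea.CI (markov_step P e) (\<lambda>_. count_space UNIV)) (\<lambda>_. count_space UNIV)"

lemma Ionescu_Tulcea_markov_step:
  "Ionescu_Tulcea (markov_step P e) (\<lambda>_. count_space (UNIV :: 'e::countable set))"
proof (rule Ionescu_Tulcea.intro)
  let ?M = "\<lambda>_::nat. count_space (UNIV :: 'e set)"
  show "markov_step P e i \<in> measurable (PiM {0..<i} ?M) (subprob_algebra (count_space UNIV))" for i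
  proof (cases i)
    case 0
    have "markov_step P e 0 = (\<lambda>_. return (count_space UNIV) e)"
      by (simp add: fun_eq_iff)
    then show ?thesis
      using 0 by (auto intro!: measurable_const return_measurable[THEN measurable_space])
  next
    case (Suc n)
    have "(\<lambda>\<omega>. \<omega> n) \<in> measurable (PiM {0..<Suc n} ?M) (count_space UNIV)"
      by (rule measurable_component_singleton) auto
    then have "(\<lambda>\<omega>. measure_pmf (P (\<omega> n))) \<in>
        measurable (PiM {0..<Suc n} ?M) (subprob_algebra (count_space UNIV))"
      by (rule measurable_compose)
         (simp add: space_subprob_algebra measure_pmf.subprob_space_axioms)
    moreover have "markov_step P e (Suc n) = (\<lambda>\<omega>. measure_pmf (P (\<omega> n)))"
      by (simp add: fun_eq_iff)
    ultimately show ?thesis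
      using Suc by simp
  qed
  show "prob_space (markov_step P e i x)" if "x \<in> space (PiM {0..<i} ?M)" for i x
    by (cases i) (auto intro!: prob_space_return measure_pmf.prob_space_axioms)
qed

lemma emeasure_markov_measure_cylinder:
  fixes P :: "'e::countable \<Rightarrow> 'e pmf"
  shows "emeasure (markov_measure P e) {\<omega>. \<forall>k\<le>n. \<omega> k = w k} =
    ennreal ((if w 0 = e then 1 else 0) * (\<Prod>k<n. pmf (P (w k)) (w (Suc k))))"
proof -
  let ?M = "\<lambda>_::nat. count_space (UNIV :: 'e set)"
  interpret IT: Ionescu_Tulcea "markov_step P e" ?M
    by (rule Ionescu_Tulcea_markov_step)
  have sp: "space (PiM J ?M) = PiE J (\<lambda>_. UNIV)" for J
    by (simp add: space_PiM)
  have meas: "{restrict w {0..<m}} \<in> sets (PiM {0..<m} ?M)" for m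
  proof -
    have "{restrict w {0..<m}} = PiE {0..<m} (\<lambda>i. {w i})"
      by (auto simp: PiE_iff extensional_def restrict_def fun_eq_iff)
    then show ?thesis by (auto intro!: sets_PiM_I_finite)
  qed
  have u: "(\<lambda>_. undefined) \<in> space (PiM {0..<0} ?M)"
    by (simp add: sp)
  have step: "emeasure (IT.C 0 (Suc m) (\<lambda>_. undefined)) {restrict w {0..<Suc m}} =
      emeasure (markov_step P e m w) {w m} *
      emeasure (IT.C 0 m (\<lambda>_. undefined)) {restrict w {0..<m}}" for m
  proof -
    let ?C = "IT.C 0 m (\<lambda>_. undefined)"
    have spC: "space ?C = space (PiM {0..<m} ?M)" and sC: "sets ?C = sets (PiM {0..<m} ?M)"
      using IT.space_C[OF u, of m] IT.sets_C[OF u, of m] by simp_all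
    have mstep: "markov_step P e m (restrict w {0..<m}) = markov_step P e m w"
      by (cases m) auto
    have "emeasure (IT.C 0 (Suc m) (\<lambda>_. undefined)) {restrict w {0..<Suc m}} =
        (\<integral>\<^sup>+\<omega>. emeasure (IT.eP m \<omega>) {restrict w {0..<Suc m}} \<partial>?C)"
    proof -
      have "IT.eP m \<in> measurable ?C (subprob_algebra (PiM {0..<Suc m} ?M))"
        using IT.measurable_eP[of m] measurable_cong_sets[OF sC refl] by blast
      moreover have "space ?C \<noteq> {}"
        using spC by (simp add: sp PiE_eq_empty_iff)
      ultimately show ?thesis
        using emeasure_bind[OF _ _ meas[of "Suc m"]] by simp
    qed
    also have "\<dots> = (\<integral>\<^sup>+\<omega>. emeasure (markov_step P e m w) {w m} *
        indicator {restrict w {0..<m}} \<omega> \<partial>?C)"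
    proof (rule nn_integral_cong)
      fix \<omega> assume "\<omega> \<in> space ?C"
      then have \<omega>: "\<omega> \<in> space (PiM {0..<m} ?M)" using spC by simp
      have eq: "fun_upd \<omega> m x = restrict w {0..<Suc m} \<longleftrightarrow> x = w m \<and> \<omega> = restrict w {0..<m}" for x
      proof
        assume *: "fun_upd \<omega> m x = restrict w {0..<Suc m}"
        have "x = w m" using fun_cong[OF *, of m] by simp
        moreover have "\<omega> i = restrict w {0..<m} i" for i
          using fun_cong[OF *, of i] \<omega>
          by (cases "i < m") (auto simp: sp PiE_iff extensional_def)
        ultimately show "x = w m \<and> \<omega> = restrict w {0..<m}" by blast
      qed (auto simp: fun_eq_iff)
      have vim: "(\<lambda>x. fun_upd \<omega> m x) -` {restrict w {0..<Suc m}} =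
          (if \<omega> = restrict w {0..<m} then {w m} else {})"
        unfolding vimage_def singleton_iff eq by simp
      show "emeasure (IT.eP m \<omega>) {restrict w {0..<Suc m}} =
          emeasure (markov_step P e m w) {w m} * indicator {restrict w {0..<m}} \<omega>"
        using mstep by (simp add: IT.emeasure_eP[OF \<omega> meas] vim)
    qed
    also have "\<dots> = emeasure (markov_step P e m w) {w m} * emeasure ?C {restrict w {0..<m}}"
      by (rule nn_integral_cmult_indicator) (simp add: sC meas)
    finally show ?thesis .
  qed
  have C: "emeasure (IT.C 0 (Suc m) (\<lambda>_. undefined)) {restrict w {0..<Suc m}} =
      ennreal ((if w 0 = e then 1 else 0) * (\<Prod>k<m. pmf (P (w k)) (w (Suc k))))" for m
  proof (induction m)
    case 0
    have "emeasure (IT.C 0 0 (\<lambda>_. undefined)) {restrict w {0..<0}} = 1"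
      using meas[of 0] by (simp add: restrict_def)
    then show ?case
      unfolding step[of 0] by (simp add: indicator_def del: IT.C.simps)
  next
    case (Suc m)
    show ?case
      unfolding step[of "Suc m"] Suc
      by (simp add: emeasure_pmf_single ennreal_mult'[symmetric] mult_ac prod_nonneg)
  qed
  have emb: "{\<omega>. \<forall>k\<le>n. \<omega> k = w k} = prod_emb UNIV ?M {0..<Suc n} {restrict w {0..<Suc n}}"
    by (auto simp: prod_emb_def sp fun_eq_iff restrict_def less_Suc_eq_le split: if_splits; metis)
  have "emeasure (markov_measure P e) {\<omega>. \<forall>k\<le>n. \<omega> k = w k} =
      emeasure (IT.CI {0..<Suc n}) {restrict w {0..<Suc n}}"
    unfolding markov_measure_def emb using IT.lim[OF _ meas] by simp
  also have "\<dots> = emeasure (IT.C 0 (Suc n) (\<lambda>_. undefined))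
      (prod_emb {0..<Suc n} ?M {0..<Suc n} {restrict w {0..<Suc n}})"
    by (rule IT.emeasure_CI) (use meas in auto)
  also have "prod_emb {0..<Suc n} ?M {0..<Suc n} {restrict w {0..<Suc n}} = {restrict w {0..<Suc n}}"
    by (rule prod_emb_id) (auto simp: PiE_iff)
  finally show ?thesis
    unfolding C .
qed

definition return_time :: "'e \<Rightarrow> (nat \<Rightarrow> 'e) \<Rightarrow> enat" where
  "return_time e \<omega> = Inf {enat n | n. n \<ge> 1 \<and> \<omega> n = e}"

definition irreducible_chain :: "('e \<Rightarrow> 'e pmf) \<Rightarrow> bool" where
  "irreducible_chain P \<longleftrightarrow>
     (\<forall>e e'. emeasure (markov_measure P e)
               {\<omega> \<in> space (markov_measure P e). return_time e' \<omega> < \<infinity>} > 0)"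

definition positive_recurrent_chain :: "('e \<Rightarrow> 'e pmf) \<Rightarrow> bool" where
  "positive_recurrent_chain P \<longleftrightarrow>
     (\<forall>e. (\<integral>\<^sup>+\<omega>. ennreal_of_enat (return_time e \<omega>) \<partial>markov_measure P e) < \<infinity>)"

definition stationary_distribution :: "('e \<Rightarrow> 'e pmf) \<Rightarrow> 'e pmf \<Rightarrow> bool" where
  "stationary_distribution P \<pi> \<longleftrightarrow> bind_pmf \<pi> P = \<pi>"

definition action_space :: "'x topology \<Rightarrow> ('e \<times> 'x) measure" where
  "action_space X = count_space UNIV \<Otimes>\<^sub>M borel_of X"

definition action_kernel ::
    "'x topology \<Rightarrow> ('g \<Rightarrow> 'x \<Rightarrow> 'x) \<Rightarrow> ('e \<Rightarrow> 'g) \<Rightarrow> ('e \<Rightarrow> 'e pmf) \<Rightarrow>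
     'e \<times> 'x \<Rightarrow> ('e \<times> 'x) measure" where
  "action_kernel X act g P =
     (\<lambda>(e, x). measure_pmf (P e) \<Otimes>\<^sub>M return (borel_of X) (act (g e) x))"

definition action_stationary ::
    "'x topology \<Rightarrow> ('g \<Rightarrow> 'x \<Rightarrow> 'x) \<Rightarrow> ('e \<Rightarrow> 'g) \<Rightarrow> ('e \<Rightarrow> 'e pmf) \<Rightarrow>
     ('e \<times> 'x) measure set" where
  "action_stationary X act g P =
     {\<nu> \<in> prob_measures_on (action_space X).
        \<forall>A\<in>sets (action_space X).
          (\<integral>\<^sup>+z. emeasure (action_kernel X act g P z) A \<partial>\<nu>) = emeasure \<nu> A}"

definition action_ergodic ::
    "'x topology \<Rightarrow> ('g \<Rightarrow> 'x \<Rightarrow> 'x) \<Rightarrow> ('e \<Rightarrow> 'g) \<Rightarrow> ('e \<Rightarrow> 'e pmf) \<Rightarrow>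
     ('e \<times> 'x) measure \<Rightarrow> bool" where
  "action_ergodic X act g P \<nu> \<longleftrightarrow> extremal_in (action_stationary X act g P) \<nu>"

text \<open>
  Words are lists read as written, so the word \<open>e\<^bsub>n-1\<^esub>\<dots>e\<^bsub>0\<^esub>\<close> is the list \<open>[e\<^bsub>n-1\<^esub>, \<dots>, e\<^bsub>0\<^esub>]\<close>
  and its letter \<open>e\<^bsub>k\<^esub>\<close> is \<open>rev w ! k\<close>.
\<close>

definition word_prod :: "('g, 'm) monoid_scheme \<Rightarrow> ('e \<Rightarrow> 'g) \<Rightarrow> 'e list \<Rightarrow> 'g" where
  "word_prod G g w = foldr (\<lambda>e h. g e \<otimes>\<^bsub>G\<^esub> h) w \<one>\<^bsub>G\<^esub>"

definition letter :: "'e list \<Rightarrow> nat \<Rightarrow> 'e" where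
  "letter w k = rev w ! k"

text \<open>\<open>admissible P e e' w\<close> is \<open>(e\<leftarrow>e')\<close>-admissibility.\<close>

definition admissible :: "('e \<Rightarrow> 'e pmf) \<Rightarrow> 'e \<Rightarrow> 'e \<Rightarrow> 'e list \<Rightarrow> bool" where
  "admissible P e e' w \<longleftrightarrow>
     w \<noteq> [] \<and> letter w 0 = e' \<and>
     (\<forall>k\<in>{1..length w - 1}. pmf (P (letter w (k - 1))) (letter w k) > 0) \<and>
     pmf (P (letter w (length w - 1))) e > 0"

text \<open>
  The value \<open>\<one>\<close> on the event that the return time is infinite is an arbitrary choice: for a
  recurrent chain this event is null.
\<close>

definition renewal_product ::
    "('g, 'm) monoid_scheme \<Rightarrow> ('e \<Rightarrow> 'g) \<Rightarrow> 'e \<Rightarrow> (nat \<Rightarrow> 'e) \<Rightarrow> 'g" where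
  "renewal_product G g e \<omega> =
     (case return_time e \<omega> of enat n \<Rightarrow> word_prod G g (map \<omega> (rev [0..<n])) | \<infinity> \<Rightarrow> \<one>\<^bsub>G\<^esub>)"

definition renewal_measure ::
    "('g, 'm) monoid_scheme \<Rightarrow> 'g topology \<Rightarrow> ('e \<Rightarrow> 'g) \<Rightarrow> ('e \<Rightarrow> 'e pmf) \<Rightarrow> 'e \<Rightarrow> 'g measure" where
  "renewal_measure G T g P e = distr (markov_measure P e) (borel_of T) (renewal_product G g e)"

definition closed_subsemigroup_generated ::
    "('g, 'm) monoid_scheme \<Rightarrow> 'g topology \<Rightarrow> 'g set \<Rightarrow> 'g set" where
  "closed_subsemigroup_generated G T A =
     \<Inter>{S. closedin T S \<and> A \<subseteq> S \<and> (\<forall>a\<in>S. \<forall>b\<in>S. a \<otimes>\<^bsub>G\<^esub> b \<in> S)}"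

definition renewal_semigroup ::
    "('g, 'm) monoid_scheme \<Rightarrow> 'g topology \<Rightarrow> ('e \<Rightarrow> 'g) \<Rightarrow> ('e \<Rightarrow> 'e pmf) \<Rightarrow> 'e \<Rightarrow> 'g set" where
  "renewal_semigroup G T g P e =
     closed_subsemigroup_generated G T (measure_support T (renewal_measure G T g P e))"

definition pushforward ::
    "'x topology \<Rightarrow> ('g \<Rightarrow> 'x \<Rightarrow> 'x) \<Rightarrow> 'g \<Rightarrow> 'x measure \<Rightarrow> 'x measure" where
  "pushforward X act h \<eta> = distr \<eta> (borel_of X) (act h)"

definition mu_stationary ::
    "'x topology \<Rightarrow> ('g \<Rightarrow> 'x \<Rightarrow> 'x) \<Rightarrow> 'g measure \<Rightarrow> 'x measure set" where
  "mu_stationary X act \<mu> =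
     {\<eta> \<in> prob_measures_on (borel_of X).
        \<forall>A\<in>sets (borel_of X). (\<integral>\<^sup>+h. emeasure (pushforward X act h \<eta>) A \<partial>\<mu>) = emeasure \<eta> A}"

definition mu_ergodic ::
    "'x topology \<Rightarrow> ('g \<Rightarrow> 'x \<Rightarrow> 'x) \<Rightarrow> 'g measure \<Rightarrow> 'x measure \<Rightarrow> bool" where
  "mu_ergodic X act \<mu> \<eta> \<longleftrightarrow> extremal_in (mu_stationary X act \<mu>) \<eta>"

definition invariant_under ::
    "'x topology \<Rightarrow> ('g \<Rightarrow> 'x \<Rightarrow> 'x) \<Rightarrow> 'g set \<Rightarrow> 'x measure \<Rightarrow> bool" where
  "invariant_under X act S \<eta> \<longleftrightarrow> (\<forall>h\<in>S. pushforward X act h \<eta> = \<eta>)"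

text \<open>\<^term>\<open>absolutely_continuous \<eta> \<eta>'\<close> means \<open>\<eta>' \<ll> \<eta>\<close>, with the dominating measure first.\<close>

definition same_measure_class :: "'x measure \<Rightarrow> 'x measure \<Rightarrow> bool" where
  "same_measure_class \<eta> \<eta>' \<longleftrightarrow> absolutely_continuous \<eta> \<eta>' \<and> absolutely_continuous \<eta>' \<eta>"

end

theory Submission
  imports Defs
begin

text \<open>
  Write \<open>m\<^sub>f = \<nu>({f} \<times> \<cdot>)\<close>. Stationarity of \<open>\<nu>\<close> says that the family \<open>m\<close> is invariant:
  \<open>m\<^sub>f = \<Sum>\<^sub>a p\<^bsub>f,a\<^esub> (g\<^sub>a)\<^sub>* m\<^sub>a\<close>. Fix a state \<open>e\<close>. Iterating this identity, but stopping whenever the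
  path backwards in time meets \<open>e\<close>, bounds \<open>m\<^sub>f\<close> from below by \<open>K\<^sub>f(m\<^sub>e)\<close>, the sum over all excursions
  \<open>w\<close> from \<open>e\<close> to \<open>f\<close> of the probability of \<open>w\<close> times \<open>(g\<^sub>w)\<^sub>* m\<^sub>e\<close>. At \<open>f = e\<close> recurrence makes the
  total masses equal, irreducibility carries this over to every \<open>f\<close>, and hence \<open>m\<^sub>f = K\<^sub>f(m\<^sub>e)\<close>. The scalar
  case of this identity shows that the masses of the \<open>m\<^sub>f\<close> are given by \<open>\<pi>\<close>; the case \<open>f = e\<close> is
  \<open>\<mu>\<^sub>e\<close>-stationarity of \<open>m\<^sub>e\<close>, because \<open>K\<^sub>e\<close> is integration against the renewal measure.
  Conversely, a \<open>\<mu>\<^sub>e\<close>-stationary \<open>\<eta>\<close> yields the invariant family \<open>K\<^sub>f(\<eta>)\<close>. As \<open>K\<close> is linear, a convex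
  decomposition of \<open>\<nu>\<^sub>e\<close> thus induces one of \<open>\<nu>\<close>, which gives ergodicity. Absolute continuity holds
  because null sets propagate backwards along admissible words; for the converse, close up the word
  \<open>c\<close> to a loop at \<open>e\<close>, whose product lies in \<open>G\<^sub>e\<^sup>+\<close> by splitting the loop at its visits to \<open>e\<close>.
\<close>

subsection \<open>Countable sums\<close>

text \<open>The sums over states in the theorem become integrals against counting measure, where
  monotone convergence and the exchange of integrals apply.\<close>

lemma infsum_ennreal_eq_nn_integral:
  fixes f :: "'a::countable \<Rightarrow> ennreal"
  shows "(\<Sum>\<^sub>\<infinity>x. f x) = (\<integral>\<^sup>+x. f x \<partial>count_space UNIV)"
proof (rule antisym)
  show "(\<Sum>\<^sub>\<infinity>x. f x) \<le> (\<integral>\<^sup>+x. f x \<partial>count_space UNIV)"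
  proof (subst nonneg_infsum_complete, simp, rule SUP_least)
    fix F :: "'a set" assume "F \<in> {F. finite F \<and> F \<subseteq> UNIV}"
    then have "sum f F = (\<integral>\<^sup>+x. f x * indicator F x \<partial>count_space UNIV)"
      by (simp add: nn_integral_count_space_finite flip: nn_integral_count_space_indicator)
    also have "\<dots> \<le> (\<integral>\<^sup>+x. f x \<partial>count_space UNIV)"
      by (rule nn_integral_mono) (simp split: split_indicator)
    finally show "sum f F \<le> (\<integral>\<^sup>+x. f x \<partial>count_space UNIV)" .
  qed
next
  \<comment> \<open>The injection \<open>to_nat\<close> exhausts the countable type by an increasing
    sequence of finite sets.\<close>
  define S where "S n = {x::'a. to_nat x \<le> n}" for n
  have fin: "finite (S n)" for n
    unfolding S_def by (rule finite_imageD[of to_nat]) (auto intro: finite_subset[of _ "{..n}"] inj_on_subset)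
  have sup: "f x = (SUP n. f x * indicator (S n) x)" for x
  proof (rule antisym)
    have "f x = f x * indicator (S (to_nat x)) x"
      by (simp add: S_def)
    then show "f x \<le> (SUP n. f x * indicator (S n) x)"
      by (metis SUP_upper UNIV_I)
  qed (auto intro!: SUP_least split: split_indicator)
  have "(\<integral>\<^sup>+x. f x \<partial>count_space UNIV) = (\<integral>\<^sup>+x. (SUP n. f x * indicator (S n) x) \<partial>count_space UNIV)"
    by (rule nn_integral_cong) (rule sup)
  also have "\<dots> = (SUP n. \<integral>\<^sup>+x. f x * indicator (S n) x \<partial>count_space UNIV)"
    by (rule nn_integral_monotone_convergence_SUP)
       (auto simp: incseq_def le_fun_def S_def split: split_indicator)
  also have "\<dots> = (SUP n. sum f (S n))"
    using fin by (simp add: nn_integral_count_space_finite flip: nn_integral_count_space_indicator)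
  also have "\<dots> \<le> (\<Sum>\<^sub>\<infinity>x. f x)"
    by (subst nonneg_infsum_complete, simp, rule SUP_least, rule SUP_upper) (simp add: fin)
  finally show "(\<integral>\<^sup>+x. f x \<partial>count_space UNIV) \<le> (\<Sum>\<^sub>\<infinity>x. f x)" .
qed

text \<open>Splitting off the head of a word, that is its latest letter, is the source of the
  recursions for sums over words.\<close>

lemma nn_integral_count_space_list:
  fixes F :: "'a::countable list \<Rightarrow> ennreal"
  shows "(\<integral>\<^sup>+w. F w \<partial>count_space UNIV) =
    F [] + (\<integral>\<^sup>+a. \<integral>\<^sup>+w. F (a # w) \<partial>count_space UNIV \<partial>count_space UNIV)"
proof -
  have bij: "bij_betw (\<lambda>(a, w). a # w) (UNIV :: ('a \<times> 'a list) set) (- {[]})"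
    unfolding bij_betw_def
    by (auto simp: inj_on_def image_iff) (metis neq_Nil_conv)
  have "(\<integral>\<^sup>+w. F w \<partial>count_space UNIV) =
      (\<integral>\<^sup>+w. F w * indicator {[]} w + F w * indicator (- {[]}) w \<partial>count_space UNIV)"
    by (rule nn_integral_cong) (simp split: split_indicator)
  also have "\<dots> = (\<integral>\<^sup>+w. F w \<partial>count_space {[]}) + (\<integral>\<^sup>+w. F w \<partial>count_space (- {[]}))"
    by (subst nn_integral_add) (simp_all add: nn_integral_count_space_indicator)
  also have "(\<integral>\<^sup>+w. F w \<partial>count_space {[]}) = F []"
    by (simp add: nn_integral_count_space_finite)
  also have "(\<integral>\<^sup>+w. F w \<partial>count_space (- {[]})) = (\<integral>\<^sup>+(a, w). F (a # w) \<partial>count_space UNIV)"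
    by (subst nn_integral_bij_count_space[OF bij, symmetric]) (simp add: case_prod_unfold)
  also have "\<dots> = (\<integral>\<^sup>+a. \<integral>\<^sup>+w. F (a # w) \<partial>count_space UNIV \<partial>count_space UNIV)"
    by (subst nn_integral_fst_count_space[symmetric]) simp
  finally show ?thesis .
qed

text \<open>Since the total is finite, the difference \<open>v x - u x\<close> integrates to 0, and
  counting measure has no non-empty null sets.\<close>

lemma nn_integral_count_space_eqD:
  fixes u v :: "'a \<Rightarrow> ennreal"
  assumes "\<And>x. u x \<le> v x" "(\<integral>\<^sup>+x. v x \<partial>count_space UNIV) = (\<integral>\<^sup>+x. u x \<partial>count_space UNIV)"
    "(\<integral>\<^sup>+x. u x \<partial>count_space UNIV) \<noteq> \<infinity>"
  shows "u x = v x"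
proof -
  have "(\<integral>\<^sup>+x. v x - u x \<partial>count_space UNIV) = 0"
    using assms by (subst nn_integral_diff) (auto simp: diff_eq_0_iff_ennreal less_top)
  then have "v x - u x = 0"
    by (simp add: nn_integral_0_iff_AE AE_count_space)
  moreover have "v x \<le> (\<integral>\<^sup>+x. v x \<partial>count_space UNIV)"
    by (rule nn_integral_ge_point) simp
  ultimately show ?thesis
    using assms by (metis antisym diff_eq_0_iff_ennreal order_less_imp_le top.not_eq_extremum infinity_ennreal_def)
qed

text \<open>\<open>N\<close> only supplies the space and the \<sigma>-algebra. The set function is
  countably additive as soon as every \<open>M i\<close> lives on this \<sigma>-algebra.\<close>

definition weighted_sum_measure ::
    "'a measure \<Rightarrow> ('i \<Rightarrow> ennreal) \<Rightarrow> ('i \<Rightarrow> 'a measure) \<Rightarrow> 'a measure" where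
  "weighted_sum_measure N c M =
     measure_of (space N) (sets N) (\<lambda>A. \<integral>\<^sup>+i. c i * emeasure (M i) A \<partial>count_space UNIV)"

lemma sets_weighted_sum_measure [simp, measurable_cong]:
  "sets (weighted_sum_measure N c M) = sets N"
  by (simp add: weighted_sum_measure_def)

lemma emeasure_weighted_sum_measure:
  fixes N :: "'a measure"
  assumes M: "\<And>i. sets (M i) = sets N" and A: "A \<in> sets N"
  shows "emeasure (weighted_sum_measure N c M) A = (\<integral>\<^sup>+i. c i * emeasure (M i) A \<partial>count_space UNIV)"
  unfolding weighted_sum_measure_def
proof (rule emeasure_measure_of_sigma)
  show "countably_additive (sets N) (\<lambda>A. \<integral>\<^sup>+i. c i * emeasure (M i) A \<partial>count_space UNIV)"
  proof (rule countably_additiveI)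
    fix F :: "nat \<Rightarrow> 'a set" assume F: "range F \<subseteq> sets N" "disjoint_family F"
    have "(\<Sum>k. \<integral>\<^sup>+i. c i * emeasure (M i) (F k) \<partial>count_space UNIV) =
        (\<integral>\<^sup>+i. (\<Sum>k. c i * emeasure (M i) (F k)) \<partial>count_space UNIV)"
      by (rule nn_integral_suminf[symmetric]) simp
    also have "\<dots> = (\<integral>\<^sup>+i. c i * emeasure (M i) (\<Union>k. F k) \<partial>count_space UNIV)"
      using F by (intro nn_integral_cong) (simp add: M suminf_emeasure)
    finally show "(\<Sum>k. \<integral>\<^sup>+i. c i * emeasure (M i) (F k) \<partial>count_space UNIV) =
        (\<integral>\<^sup>+i. c i * emeasure (M i) (\<Union>k. F k) \<partial>count_space UNIV)" .
  qed
qed (use A in \<open>auto simp: positive_def sets.sigma_algebra_axioms\<close>)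

subsection \<open>Paths and excursions\<close>

text \<open>As in \<^const>\<open>word_prod\<close>, words are listed with the latest letter first; \<open>f\<close> is the state that is
  entered after the word, and \<open>e\<close> the state in which it starts.\<close>

primrec path_to :: "('e \<Rightarrow> 'e pmf) \<Rightarrow> 'e \<Rightarrow> 'e list \<Rightarrow> bool" where
  "path_to P f [] \<longleftrightarrow> True"
| "path_to P f (a # w) \<longleftrightarrow> pmf (P a) f > 0 \<and> path_to P a w"

primrec path_weight :: "('e \<Rightarrow> 'e pmf) \<Rightarrow> 'e \<Rightarrow> 'e \<Rightarrow> 'e list \<Rightarrow> ennreal" where
  "path_weight P e f [] = (if f = e then 1 else 0)"
| "path_weight P e f (a # w) = ennreal (pmf (P a) f) * path_weight P e a w"

text \<open>The path weight restricted to words in which \<open>e\<close> occurs only as the oldest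
  letter. The empty word has weight 0, because an excursion takes at least one step; the entered
  state \<open>f\<close> may be \<open>e\<close> again.\<close>

primrec excursion_weight :: "('e \<Rightarrow> 'e pmf) \<Rightarrow> 'e \<Rightarrow> 'e \<Rightarrow> 'e list \<Rightarrow> ennreal" where
  "excursion_weight P e f [] = 0"
| "excursion_weight P e f (a # w) = ennreal (pmf (P a) f) *
     (if a = e then (if w = [] then 1 else 0) else excursion_weight P e a w)"

text \<open>A preimage under a composition takes the outermost map first, hence the head of the
  word, its latest letter, is pulled back first.\<close>

primrec pull_word :: "('e \<Rightarrow> 'a \<Rightarrow> 'a) \<Rightarrow> 'e list \<Rightarrow> 'a \<Rightarrow> 'a" where
  "pull_word pull [] A = A"
| "pull_word pull (a # w) A = pull_word pull w (pull a A)"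

text \<open>Stated for arbitrary functions on a set with pull-back maps, so that it covers both measures
  (\<open>pull a A = g\<^sub>a\<^sup>-\<^sup>1 A\<close>) and scalars (\<open>pull a A = A\<close>).\<close>

definition excursion_sum ::
    "('e \<Rightarrow> 'e pmf) \<Rightarrow> 'e \<Rightarrow> ('e \<Rightarrow> 'a \<Rightarrow> 'a) \<Rightarrow> ('a \<Rightarrow> ennreal) \<Rightarrow> 'e \<Rightarrow> 'a \<Rightarrow> ennreal" where
  "excursion_sum P e pull s f A =
     (\<integral>\<^sup>+w. excursion_weight P e f w * s (pull_word pull w A) \<partial>count_space UNIV)"

lemma nn_integral_singleton_Nil:
  "(\<integral>\<^sup>+w. (if w = [] then 1 else 0) * F w \<partial>count_space UNIV) = F []"
proof -
  have "(\<integral>\<^sup>+w. (if w = [] then 1 else 0) * F w \<partial>count_space UNIV) =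
      (\<integral>\<^sup>+w. F w * indicator {[]} w \<partial>count_space UNIV)"
    by (rule nn_integral_cong) (simp split: split_indicator)
  also have "\<dots> = F []"
    by (simp add: nn_integral_count_space_finite flip: nn_integral_count_space_indicator)
  finally show ?thesis .
qed

text \<open>Decomposition by the state \<open>a\<close> visited just before \<open>f\<close>: if
  \<open>a = e\<close>, the excursion is the one-letter word; otherwise the rest of the word is an
  excursion from \<open>e\<close> to \<open>a\<close>.\<close>

lemma excursion_sum_step:
  fixes P :: "'e::countable \<Rightarrow> 'e pmf"
  shows "excursion_sum P e pull s f A =
    (\<integral>\<^sup>+a. ennreal (pmf (P a) f) *
       (if a = e then s (pull a A) else excursion_sum P e pull s a (pull a A)) \<partial>count_space UNIV)"
  unfolding excursion_sum_def
  by (subst nn_integral_count_space_list, simp, rule nn_integral_cong)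
     (simp add: mult.assoc nn_integral_cmult nn_integral_singleton_Nil)

text \<open>Only words of length at most \<open>n\<close> are summed first. Induction on
  \<open>n\<close> bounds this by \<open>m\<close>: one use of invariance expands
  \<open>m f\<close>, the term at \<open>e\<close> is kept, and the induction hypothesis bounds the
  others. Monotone convergence removes the truncation.\<close>

lemma excursion_sum_le:
  fixes P :: "'e::countable \<Rightarrow> 'e pmf" and m :: "'e \<Rightarrow> 'a \<Rightarrow> ennreal"
  assumes pull: "\<And>a A. A \<in> \<S> \<Longrightarrow> pull a A \<in> \<S>"
    and inv: "\<And>f A. A \<in> \<S> \<Longrightarrow> m f A = (\<integral>\<^sup>+a. ennreal (pmf (P a) f) * m a (pull a A) \<partial>count_space UNIV)"
    and A: "A \<in> \<S>"
  shows "excursion_sum P e pull (m e) f A \<le> m f A"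
proof -
  define t where "t n f A = (\<integral>\<^sup>+w. excursion_weight P e f w * m e (pull_word pull w A) *
      indicator {w. length w \<le> n} w \<partial>count_space UNIV)" for n f A
  have t_le: "t n f A \<le> m f A" if "A \<in> \<S>" for n f A
    using that
  proof (induction n arbitrary: f A)
    case 0
    have "t 0 f A = (\<integral>\<^sup>+w. 0 \<partial>count_space (UNIV :: 'e list set))"
      unfolding t_def by (rule nn_integral_cong) (simp split: split_indicator)
    then show ?case by simp
  next
    case (Suc n)
    have ind: "indicator {w. length w \<le> Suc n} (a # w) = (indicator {w. length w \<le> n} w :: ennreal)"
      for a :: 'e and w
      by (simp split: split_indicator)
    have "t (Suc n) f A = (\<integral>\<^sup>+a. ennreal (pmf (P a) f) *
        (if a = e then m e (pull a A) else t n a (pull a A)) \<partial>count_space UNIV)"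
      unfolding t_def
      by (subst nn_integral_count_space_list, simp add: ind, rule nn_integral_cong)
         (simp add: mult.assoc nn_integral_cmult nn_integral_singleton_Nil)
    also have "\<dots> \<le> (\<integral>\<^sup>+a. ennreal (pmf (P a) f) * m a (pull a A) \<partial>count_space UNIV)"
      using Suc pull by (intro nn_integral_mono mult_left_mono) auto
    also have "\<dots> = m f A"
      using inv Suc by simp
    finally show ?case .
  qed
  have "excursion_sum P e pull (m e) f A = (\<integral>\<^sup>+w. (SUP n. excursion_weight P e f w *
      m e (pull_word pull w A) * indicator {w. length w \<le> n} w) \<partial>count_space UNIV)"
    unfolding excursion_sum_def
  proof (rule nn_integral_cong)
    fix w
    let ?c = "excursion_weight P e f w * m e (pull_word pull w A)"
    have "?c * indicator {w. length w \<le> length w} w \<le> (SUP n. ?c * indicator {w. length w \<le> n} w)"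
      by (rule SUP_upper2[where i = "length w"]) (auto split: split_indicator)
    then show "?c = (SUP n. ?c * indicator {w. length w \<le> n} w)"
      by (intro antisym SUP_least) (auto split: split_indicator)
  qed
  also have "\<dots> = (SUP n. t n f A)"
    unfolding t_def
    by (rule nn_integral_monotone_convergence_SUP)
       (auto simp: incseq_def le_fun_def split: split_indicator)
  also have "\<dots> \<le> m f A"
    by (rule SUP_least) (rule t_le[OF A])
  finally show ?thesis .
qed

text \<open>The expected number of visits to \<open>f\<close> at the times from 1 up to and
  including the return time to \<open>e\<close>, for the chain started in \<open>e\<close>. For
  \<open>f = e\<close> it is the probability of return.\<close>

definition excursion_mass :: "('e \<Rightarrow> 'e pmf) \<Rightarrow> 'e \<Rightarrow> 'e \<Rightarrow> ennreal" where
  "excursion_mass P e f = (\<integral>\<^sup>+w. excursion_weight P e f w \<partial>count_space UNIV)"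

lemma excursion_sum_const:
  "excursion_sum P e (\<lambda>_ A. A) (\<lambda>_. c) f A = c * excursion_mass P e f"
  by (simp add: excursion_sum_def excursion_mass_def nn_integral_cmult mult.commute[of _ c])

text \<open>The multiple \<open>b\<close> of the excursion mass is invariant, lies below
  \<open>a\<close> and agrees with it at \<open>e\<close>. Where they agree at \<open>y\<close>, the
  finite sums expressing invariance at \<open>y\<close> agree term by term, so they also agree at
  every \<open>x\<close> with a transition to \<open>y\<close>. By \<open>paths\<close> this spreads
  backwards from \<open>e\<close> to all states.\<close>

lemma invariant_eq_excursion_mass:
  fixes P :: "'e::countable \<Rightarrow> 'e pmf" and a :: "'e \<Rightarrow> ennreal"
  assumes inv: "\<And>f. a f = (\<integral>\<^sup>+x. ennreal (pmf (P x) f) * a x \<partial>count_space UNIV)"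
    and fin: "\<And>f. a f \<noteq> \<infinity>"
    and mass: "excursion_mass P e e = 1"
    and paths: "\<And>f. \<exists>w. w \<noteq> [] \<and> last w = f \<and> path_to P e w"
  shows "a f = a e * excursion_mass P e f"
proof -
  define b where "b f = a e * excursion_mass P e f" for f
  have b_e: "b e = a e"
    by (simp add: b_def mass)
  \<comment> \<open>The scalar case of the comparison: functions constant on a dummy type, here the
    naturals, with trivial pull-backs.\<close>
  have b_le: "b f \<le> a f" for f
    using excursion_sum_le[of UNIV "\<lambda>_ A. A" "\<lambda>f (_::nat). a f" P 0 e f, OF _ inv]
    by (simp add: b_def excursion_sum_const)
  have b_inv: "b f = (\<integral>\<^sup>+x. ennreal (pmf (P x) f) * b x \<partial>count_space UNIV)" for f
  proof -
    have "b f = (\<integral>\<^sup>+x. ennreal (pmf (P x) f) * (if x = e then a e else b x) \<partial>count_space UNIV)"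
      using excursion_sum_step[of P e "\<lambda>_ A. A" "\<lambda>_. a e" f "0::nat"]
      unfolding excursion_sum_const b_def .
    also have "\<dots> = (\<integral>\<^sup>+x. ennreal (pmf (P x) f) * b x \<partial>count_space UNIV)"
      by (rule nn_integral_cong) (simp add: b_e)
    finally show ?thesis .
  qed
  have step: "a x = b x" if "a y = b y" "pmf (P x) y > 0" for x y
  proof -
    have "ennreal (pmf (P x) y) * b x = ennreal (pmf (P x) y) * a x"
    proof (rule nn_integral_count_space_eqD[of "\<lambda>x. ennreal (pmf (P x) y) * b x" "\<lambda>x. ennreal (pmf (P x) y) * a x"])
      show "(\<integral>\<^sup>+x. ennreal (pmf (P x) y) * a x \<partial>count_space UNIV) =
          (\<integral>\<^sup>+x. ennreal (pmf (P x) y) * b x \<partial>count_space UNIV)"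
        unfolding inv[symmetric] b_inv[symmetric] by (rule that)
      show "(\<integral>\<^sup>+x. ennreal (pmf (P x) y) * b x \<partial>count_space UNIV) \<noteq> \<infinity>"
        unfolding b_inv[symmetric] that(1)[symmetric] by (rule fin)
    qed (intro mult_left_mono b_le zero_le)
    then show ?thesis
      using that(2) by (simp add: ennreal_mult_cancel_left)
  qed
  have "a (last w) = b (last w)" if "w \<noteq> []" "path_to P y w" "a y = b y" for w y
    using that
  proof (induction w arbitrary: y)
    case (Cons x w)
    then show ?case using step[of y x] by auto
  qed simp
  then show ?thesis
    using paths[of f] b_e b_def by metis
qed

lemma stationary_distribution_invariant:
  assumes "stationary_distribution P \<pi>"
  shows "ennreal (pmf \<pi> f) = (\<integral>\<^sup>+x. ennreal (pmf (P x) f) * ennreal (pmf \<pi> x) \<partial>count_space UNIV)"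
proof -
  have "ennreal (pmf \<pi> f) = ennreal (pmf (bind_pmf \<pi> P) f)"
    using assms by (simp add: stationary_distribution_def)
  also have "\<dots> = (\<integral>\<^sup>+x. ennreal (pmf (P x) f) * ennreal (pmf \<pi> x) \<partial>count_space UNIV)"
    by (simp add: ennreal_pmf_bind nn_integral_measure_pmf mult.commute)
  finally show ?thesis .
qed

section \<open>Admissible words as paths\<close>

lemma admissible_Cons:
  "admissible P e e' (a # w) \<longleftrightarrow>
     pmf (P a) e > 0 \<and> (if w = [] then a = e' else admissible P a e' w)"
proof (cases "w = []")
  case True
  then show ?thesis by (auto simp: admissible_def letter_def)
next
  case False
  \<comment> \<open>Letters are counted from the right, so prepending \<open>a\<close> keeps all
    indices and only adds the letter with index \<open>length w\<close>; the one new transition is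
    the one into \<open>a\<close>.\<close>
  have l: "letter (a # w) k = (if k < length w then letter w k else a)" if "k \<le> length w" for k
    using that by (auto simp: letter_def nth_append)
  obtain n where n: "length w = Suc n"
    using False by (cases w) auto
  have "(\<forall>k\<in>{1..length (a # w) - 1}. pmf (P (letter (a # w) (k - 1))) (letter (a # w) k) > 0) \<longleftrightarrow>
      (\<forall>k\<in>insert (Suc n) {1..n}. pmf (P (letter (a # w) (k - 1))) (letter (a # w) k) > 0)"
    using n by (intro ball_cong) auto
  also have "\<dots> \<longleftrightarrow> pmf (P (letter w n)) a > 0 \<and>
      (\<forall>k\<in>{1..n}. pmf (P (letter (a # w) (k - 1))) (letter (a # w) k) > 0)"
    using n by (simp add: l)
  also have "(\<forall>k\<in>{1..n}. pmf (P (letter (a # w) (k - 1))) (letter (a # w) k) > 0) \<longleftrightarrow>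
      (\<forall>k\<in>{1..n}. pmf (P (letter w (k - 1))) (letter w k) > 0)"
  proof (intro ball_cong refl)
    fix k assume "k \<in> {1..n}"
    then have "k - 1 < length w" "k < length w"
      using n by auto
    then show "pmf (P (letter (a # w) (k - 1))) (letter (a # w) k) > 0 \<longleftrightarrow>
        pmf (P (letter w (k - 1))) (letter w k) > 0"
      by (simp add: l)
  qed
  finally show ?thesis
    using False n by (simp add: admissible_def l conj_ac)
qed

lemma admissible_iff_path_to:
  "admissible P e e' w \<longleftrightarrow> w \<noteq> [] \<and> last w = e' \<and> path_to P e w"
proof (induction w arbitrary: e)
  case Nil
  then show ?case by (simp add: admissible_def)
next
  case (Cons a w)
  then show ?case by (auto simp: admissible_Cons)
qed

lemma path_to_append:
  "path_to P e (v @ w) \<longleftrightarrow> path_to P e v \<and> path_to P (if v = [] then e else last v) w"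
  by (induction v arbitrary: e) auto

subsection \<open>The law of the return word\<close>

lemma sets_markov_measure [measurable_cong]:
  fixes P :: "'e::countable \<Rightarrow> 'e pmf"
  shows "sets (markov_measure P e) = sets (PiM UNIV (\<lambda>_. count_space UNIV))"
proof -
  interpret IT: Ionescu_Tulcea "markov_step P e" "\<lambda>_. count_space (UNIV :: 'e set)"
    by (rule Ionescu_Tulcea_markov_step)
  show ?thesis
    unfolding markov_measure_def by (rule IT.PF.sets_lim)
qed

lemma space_markov_measure [simp]:
  fixes P :: "'e::countable \<Rightarrow> 'e pmf"
  shows "space (markov_measure P e) = UNIV"
  using sets_eq_imp_space_eq[OF sets_markov_measure] by (simp add: space_PiM)

lemma prob_space_markov_measure:
  fixes P :: "'e::countable \<Rightarrow> 'e pmf"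
  shows "prob_space (markov_measure P e)"
proof
  let ?M = "\<lambda>_::nat. count_space (UNIV :: 'e set)"
  interpret IT: Ionescu_Tulcea "markov_step P e" ?M
    by (rule Ionescu_Tulcea_markov_step)
  interpret CI: prob_space "IT.CI {}"
    by (rule IT.PF.prob_space_P) auto
  \<comment> \<open>The whole space is the cylinder over the empty index set, so its mass is that of
    the finite-dimensional law indexed by \<open>{}\<close>.\<close>
  have "space (PiM UNIV ?M) = prod_emb UNIV ?M {} (space (PiM {} ?M))"
    unfolding prod_emb_def space_PiM by auto
  then have "emeasure (markov_measure P e) (space (PiM UNIV ?M)) = emeasure (IT.CI {}) (space (PiM {} ?M))"
    unfolding markov_measure_def using IT.lim[of "{}" "space (PiM {} ?M)"] by simp
  also have "space (PiM {} ?M) = space (IT.CI {})"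
    by (rule IT.PF.space_P[symmetric]) auto
  finally show "emeasure (markov_measure P e) (space (markov_measure P e)) = 1"
    using CI.emeasure_space_1 by (simp add: space_PiM)
qed

lemma measurable_cylinder [measurable]:
  fixes P :: "'e::countable \<Rightarrow> 'e pmf"
  shows "{\<omega>. \<forall>k\<le>n. \<omega> k = w k} \<in> sets (markov_measure P e)"
proof -
  have "Measurable.pred (markov_measure P e) (\<lambda>\<omega>. \<forall>k\<le>n. \<omega> k = w k)"
    by measurable
  then show ?thesis
    by (simp add: pred_def)
qed

lemma return_time_eq_enat_iff:
  "return_time e \<omega> = enat n \<longleftrightarrow> n \<ge> 1 \<and> \<omega> n = e \<and> (\<forall>k. 1 \<le> k \<and> k < n \<longrightarrow> \<omega> k \<noteq> e)"
proof -
  let ?S = "{enat n | n. n \<ge> 1 \<and> \<omega> n = e}"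
  show ?thesis
  proof
    assume *: "return_time e \<omega> = enat n"
    then have "Inf ?S \<noteq> \<infinity>"
      by (simp add: return_time_def)
    \<comment> \<open>On \<open>enat\<close> the infimum of the empty set is \<infinity> and that of
      a non-empty set is its least element; so a finite return time is attained.\<close>
    then have "?S \<noteq> {}"
      unfolding Inf_enat_def by (rule contrapos_nn) (rule if_P)
    then have "Inf ?S \<in> ?S"
      unfolding Inf_enat_def using LeastI[of "\<lambda>x. x \<in> ?S"] by auto
    then have "n \<ge> 1 \<and> \<omega> n = e"
      using * by (auto simp: return_time_def)
    moreover have "\<not> k < n" if "1 \<le> k" "\<omega> k = e" for k
    proof -
      have "Inf ?S \<le> enat k"
        using that by (intro Inf_lower) auto
      then show ?thesis
        using * by (simp add: return_time_def)
    qed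
    ultimately show "n \<ge> 1 \<and> \<omega> n = e \<and> (\<forall>k. 1 \<le> k \<and> k < n \<longrightarrow> \<omega> k \<noteq> e)"
      by blast
  next
    assume *: "n \<ge> 1 \<and> \<omega> n = e \<and> (\<forall>k. 1 \<le> k \<and> k < n \<longrightarrow> \<omega> k \<noteq> e)"
    show "return_time e \<omega> = enat n"
      unfolding return_time_def
    proof (rule antisym)
      show "Inf ?S \<le> enat n"
        using * by (intro Inf_lower) auto
      show "enat n \<le> Inf ?S"
        using * by (intro Inf_greatest) (auto simp: not_less[symmetric])
    qed
  qed
qed

lemma return_time_eq_infinity_iff:
  "return_time e \<omega> = \<infinity> \<longleftrightarrow> (\<forall>k\<ge>1. \<omega> k \<noteq> e)"
proof
  assume *: "return_time e \<omega> = \<infinity>"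
  show "\<forall>k\<ge>1. \<omega> k \<noteq> e"
  proof (intro allI impI notI)
    fix k assume "k \<ge> 1" "\<omega> k = e"
    then have "return_time e \<omega> \<le> enat k"
      unfolding return_time_def by (intro Inf_lower) auto
    then show False using * by simp
  qed
next
  assume *: "\<forall>k\<ge>1. \<omega> k \<noteq> e"
  show "return_time e \<omega> = \<infinity>"
  proof (cases "return_time e \<omega>")
    case (enat n)
    then show ?thesis
      using * by (auto simp: return_time_eq_enat_iff)
  qed
qed

text \<open>The trajectory before the return, latest letter first. The default \<open>[]\<close>
  marks exactly the event of no return, since a finite return time is at least 1.\<close>

definition return_word :: "'e \<Rightarrow> (nat \<Rightarrow> 'e) \<Rightarrow> 'e list" where
  "return_word e \<omega> = (case return_time e \<omega> of enat n \<Rightarrow> map \<omega> (rev [0..<n]) | \<infinity> \<Rightarrow> [])"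

lemma renewal_product_eq: "renewal_product G g e \<omega> = word_prod G g (return_word e \<omega>)"
  by (simp add: renewal_product_def return_word_def word_prod_def split: enat.split)

lemma return_word_eq_Nil_iff: "return_word e \<omega> = [] \<longleftrightarrow> (\<forall>k\<ge>1. \<omega> k \<noteq> e)"
proof (cases "return_time e \<omega>")
  case (enat n)
  then have "n \<ge> 1" "\<omega> n = e"
    by (auto simp: return_time_eq_enat_iff)
  then show ?thesis
    using enat by (auto simp: return_word_def)
next
  case infinity
  then show ?thesis
    using return_time_eq_infinity_iff[of e \<omega>] by (simp add: return_word_def)
qed

text \<open>\<open>rev (f # w)\<close> is the trajectory in chronological order: the letters of
  \<open>w\<close> from the oldest on, then \<open>f\<close> at time \<open>length w\<close>. Thus a
  word with the state entered after it is a cylinder.\<close>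

lemma cylinder_iff_map:
  "(\<forall>k\<le>length w. \<omega> k = rev (f # w) ! k) \<longleftrightarrow> w = map \<omega> (rev [0..<length w]) \<and> \<omega> (length w) = f"
proof
  assume *: "\<forall>k\<le>length w. \<omega> k = rev (f # w) ! k"
  have "rev w = map \<omega> [0..<length w]"
    using * by (intro nth_equalityI) (auto simp: nth_append)
  then have "w = map \<omega> (rev [0..<length w])"
    by (metis rev_map rev_rev_ident)
  then show "w = map \<omega> (rev [0..<length w]) \<and> \<omega> (length w) = f"
    using * by (auto simp: nth_append)
next
  assume *: "w = map \<omega> (rev [0..<length w]) \<and> \<omega> (length w) = f"
  then have "rev w = map \<omega> [0..<length w]"
    by (metis rev_map rev_rev_ident)
  then show "\<forall>k\<le>length w. \<omega> k = rev (f # w) ! k"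
    using * by (auto simp: nth_append)
qed

lemma return_word_eq_iff:
  assumes "w \<noteq> []"
  shows "return_word e \<omega> = w \<longleftrightarrow> (\<forall>k\<le>length w. \<omega> k = rev (e # w) ! k) \<and> e \<notin> set (butlast w)"
proof -
  \<comment> \<open>\<open>butlast\<close> drops the oldest letter, at time 0, which may be
    \<open>e\<close>; what remains are the times at which a first return forbids
    \<open>e\<close>.\<close>
  have bl: "set (butlast (map \<omega> (rev [0..<n]))) = \<omega> ` {1..<n}" for n
  proof (cases n)
    case (Suc m)
    have "rev [0..<Suc m] = rev [1..<Suc m] @ [0]"
      by (simp add: upt_conv_Cons del: upt_Suc)
    then have "butlast (map \<omega> (rev [0..<Suc m])) = map \<omega> (rev [1..<Suc m])"
      by (simp del: upt_Suc)
    then show ?thesis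
      using Suc by (simp del: upt_Suc)
  qed simp
  have "return_word e \<omega> = w \<longleftrightarrow> return_time e \<omega> = enat (length w) \<and> w = map \<omega> (rev [0..<length w])"
    using assms by (auto simp: return_word_def split: enat.split)
  also have "\<dots> \<longleftrightarrow> (w = map \<omega> (rev [0..<length w]) \<and> \<omega> (length w) = e) \<and>
      e \<notin> \<omega> ` {1..<length w}"
  proof -
    have "(\<forall>k. 1 \<le> k \<and> k < length w \<longrightarrow> \<omega> k \<noteq> e) \<longleftrightarrow> e \<notin> \<omega> ` {1..<length w}"
      by force
    moreover have "length w \<ge> 1"
      using assms by (simp add: Suc_le_eq)
    ultimately show ?thesis
      unfolding return_time_eq_enat_iff by blast
  qed
  also have "\<dots> \<longleftrightarrow> (w = map \<omega> (rev [0..<length w]) \<and> \<omega> (length w) = e) \<and> e \<notin> set (butlast w)"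
    using bl[of "length w"] by auto
  finally show ?thesis
    by (simp only: cylinder_iff_map)
qed

lemma emeasure_markov_measure_path:
  fixes P :: "'e::countable \<Rightarrow> 'e pmf"
  shows "emeasure (markov_measure P e) {\<omega>. \<forall>k\<le>length w. \<omega> k = rev (f # w) ! k} = path_weight P e f w"
proof -
  have "ennreal ((if rev (f # w) ! 0 = e then 1 else 0) *
      (\<Prod>k<length w. pmf (P (rev (f # w) ! k)) (rev (f # w) ! Suc k))) = path_weight P e f w"
  proof (induction w arbitrary: f)
    case (Cons a w)
    \<comment> \<open>In chronological order \<open>f\<close> is appended at the end, so all earlier
      entries stay in place and the product only gains the factor of the last transition.\<close>
    have nth: "rev (f # a # w) ! k = rev (a # w) ! k" if "k \<le> length w" for k
      using that by (auto simp: nth_append)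
    have "(\<Prod>k<length (a # w). pmf (P (rev (f # a # w) ! k)) (rev (f # a # w) ! Suc k)) =
        (\<Prod>k<length w. pmf (P (rev (f # a # w) ! k)) (rev (f # a # w) ! Suc k)) * pmf (P a) f"
      by (simp add: nth_append)
    also have "(\<Prod>k<length w. pmf (P (rev (f # a # w) ! k)) (rev (f # a # w) ! Suc k)) =
        (\<Prod>k<length w. pmf (P (rev (a # w) ! k)) (rev (a # w) ! Suc k))"
      by (intro prod.cong refl) (simp only: nth lessThan_iff less_imp_le Suc_leI)
    finally have "ennreal ((if rev (f # a # w) ! 0 = e then 1 else 0) *
        (\<Prod>k<length (a # w). pmf (P (rev (f # a # w) ! k)) (rev (f # a # w) ! Suc k))) =
      ennreal (((if rev (a # w) ! 0 = e then 1 else 0) *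
        (\<Prod>k<length w. pmf (P (rev (a # w) ! k)) (rev (a # w) ! Suc k))) * pmf (P a) f)"
      using nth[of 0] by (simp only: mult.assoc le0)
    also have "\<dots> = ennreal ((if rev (a # w) ! 0 = e then 1 else 0) *
        (\<Prod>k<length w. pmf (P (rev (a # w) ! k)) (rev (a # w) ! Suc k))) * ennreal (pmf (P a) f)"
      by (rule ennreal_mult'') simp
    finally show ?case
      unfolding Cons.IH by (simp add: mult.commute)
  qed simp
  then show ?thesis
    using emeasure_markov_measure_cylinder[of P e "length w" "\<lambda>k. rev (f # w) ! k"] by simp
qed

lemma excursion_weight_eq:
  "excursion_weight P e f w = (if w \<noteq> [] \<and> e \<notin> set (butlast w) then path_weight P e f w else 0)"
  by (induction w arbitrary: f) auto

lemma path_weight_nonzero: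
  assumes "path_weight P e f w \<noteq> 0"
  shows "path_to P f w \<and> (w \<noteq> [] \<longrightarrow> last w = e)"
  using assms
proof (induction w arbitrary: f)
  case (Cons a w)
  then have "pmf (P a) f \<noteq> 0" and *: "path_weight P e a w \<noteq> 0"
    by auto
  then have "pmf (P a) f > 0"
    using pmf_nonneg[of "P a" f] by linarith
  then show ?case
    using Cons.IH[OF *] * by (auto split: if_splits)
qed simp

lemma path_weight_pos:
  "path_to P f w \<Longrightarrow> w \<noteq> [] \<Longrightarrow> last w = e \<Longrightarrow> path_weight P e f w > 0"
  by (induction w arbitrary: f) (auto simp: ennreal_zero_less_mult_iff split: if_splits)

text \<open>The event that the chain started in \<open>f\<close> reaches \<open>e\<close> is covered
  by the countably many cylinders of words followed by \<open>e\<close>. Without a path from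
  \<open>f\<close> to \<open>e\<close> all of them would be null, against irreducibility.\<close>

lemma irreducible_chain_path:
  fixes P :: "'e::countable \<Rightarrow> 'e pmf"
  assumes "irreducible_chain P"
  shows "\<exists>w. w \<noteq> [] \<and> last w = f \<and> path_to P e w"
proof (rule ccontr)
  assume no: "\<nexists>w. w \<noteq> [] \<and> last w = f \<and> path_to P e w"
  let ?M = "markov_measure P f"
  let ?C = "\<lambda>w. {\<omega>. \<forall>k\<le>length w. \<omega> k = rev (e # w) ! k}"
  have "?C w \<in> null_sets ?M" if "w \<noteq> []" for w
    using no that path_weight_nonzero[of P f e w]
    by (intro null_setsI) (auto simp: emeasure_markov_measure_path simp del: rev.simps)
  then have "(\<Union>w\<in>{w. w \<noteq> []}. ?C w) \<in> null_sets ?M"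
    by (intro null_sets_UN') auto
  moreover have "{\<omega> \<in> space ?M. return_time e \<omega> < \<infinity>} \<subseteq> (\<Union>w\<in>{w. w \<noteq> []}. ?C w)"
  proof
    fix \<omega> assume "\<omega> \<in> {\<omega> \<in> space ?M. return_time e \<omega> < \<infinity>}"
    then have "return_time e \<omega> \<noteq> \<infinity>"
      by simp
    then have "return_word e \<omega> \<noteq> []"
      by (simp add: return_word_eq_Nil_iff return_time_eq_infinity_iff)
    then show "\<omega> \<in> (\<Union>w\<in>{w. w \<noteq> []}. ?C w)"
      using return_word_eq_iff[of "return_word e \<omega>" e \<omega>] by blast
  qed
  ultimately have "emeasure ?M {\<omega> \<in> space ?M. return_time e \<omega> < \<infinity>} = 0"
    by (metis (no_types, lifting) emeasure_mono le_zero_eq null_setsD1 null_setsD2)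
  then show False
    using assms[unfolded irreducible_chain_def, rule_format, of f e] by (simp only: less_irrefl)
qed

lemma measurable_return_word [measurable]:
  fixes P :: "'e::countable \<Rightarrow> 'e pmf"
  shows "return_word e \<in> measurable (markov_measure P f) (count_space UNIV)"
proof (subst measurable_count_space_eq2_countable, safe)
  fix w :: "'e list"
  show "return_word e -` {w} \<inter> space (markov_measure P f) \<in> sets (markov_measure P f)"
  proof (cases "w = []")
    case True
    have "Measurable.pred (markov_measure P f) (\<lambda>\<omega>. \<forall>k\<ge>1. \<omega> k \<noteq> e)"
      by measurable
    moreover have "return_word e -` {w} = {\<omega>. \<forall>k\<ge>1. \<omega> k \<noteq> e}"
      using True by (auto simp: return_word_eq_Nil_iff)
    ultimately show ?thesis
      by (simp add: pred_def)
  next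
    case False
    have "return_word e -` {w} =
        (if e \<in> set (butlast w) then {} else {\<omega>. \<forall>k\<le>length w. \<omega> k = rev (e # w) ! k})"
      unfolding vimage_def singleton_iff return_word_eq_iff[OF False] by (simp del: rev.simps)
    then show ?thesis
      by (simp del: rev.simps)
  qed
qed simp

text \<open>For a non-empty word the event is empty or a cylinder, whose probability is the path
  weight. The empty word is the event of no return, which has to be shown null.\<close>

lemma distr_return_word:
  fixes P :: "'e::countable \<Rightarrow> 'e pmf"
  assumes "positive_recurrent_chain P"
  shows "distr (markov_measure P e) (count_space UNIV) (return_word e) =
    density (count_space UNIV) (excursion_weight P e e)"
proof (rule measure_eqI_countable[where A = UNIV])
  fix w :: "'e list"
  let ?M = "markov_measure P e"
  have *: "emeasure (distr ?M (count_space UNIV) (return_word e)) {w} = emeasure ?M (return_word e -` {w})"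
    by (subst emeasure_distr) auto
  have "emeasure ?M (return_word e -` {w}) = excursion_weight P e e w"
  proof (cases "w = []")
    case True
    \<comment> \<open>On this event the return time is infinite, so finiteness of its expectation
      makes the event null.\<close>
    let ?N = "return_word e -` {[] :: 'e list}"
    have N: "?N \<in> sets ?M"
      using measurable_sets[OF measurable_return_word, of "{[]}" e P e] by simp
    have "(\<integral>\<^sup>+\<omega>. \<infinity> * indicator ?N \<omega> \<partial>?M) \<le> (\<integral>\<^sup>+\<omega>. ennreal_of_enat (return_time e \<omega>) \<partial>?M)"
      by (rule nn_integral_mono)
         (auto simp: return_word_eq_Nil_iff return_time_eq_infinity_iff[THEN iffD2] split: split_indicator)
    also have "\<dots> < \<infinity>"
      using assms by (simp add: positive_recurrent_chain_def)
    finally have "\<infinity> * emeasure ?M ?N < \<infinity>"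
      using N by (simp add: nn_integral_cmult_indicator)
    then have "emeasure ?M ?N = 0"
      by (simp add: ennreal_top_mult split: if_splits)
    then show ?thesis
      using True by simp
  next
    case False
    have "return_word e -` {w} =
        (if e \<in> set (butlast w) then {} else {\<omega>. \<forall>k\<le>length w. \<omega> k = rev (e # w) ! k})"
      unfolding vimage_def singleton_iff return_word_eq_iff[OF False] by (simp del: rev.simps)
    then show ?thesis
      using False by (simp add: emeasure_markov_measure_path excursion_weight_eq del: rev.simps)
  qed
  then show "emeasure (distr ?M (count_space UNIV) (return_word e)) {w} =
      emeasure (density (count_space UNIV) (excursion_weight P e e)) {w}"
    unfolding * by (simp add: emeasure_density nn_integral_count_space_finite flip: nn_integral_count_space_indicator)
qed auto

text \<open>The excursion weights from \<open>e\<close> to \<open>e\<close> are the density of a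
  probability measure, the law of the return word.\<close>

lemma excursion_mass_return:
  fixes P :: "'e::countable \<Rightarrow> 'e pmf"
  assumes "positive_recurrent_chain P"
  shows "excursion_mass P e e = 1"
proof -
  interpret prob_space "markov_measure P e"
    by (rule prob_space_markov_measure)
  have "excursion_mass P e e = emeasure (density (count_space UNIV) (excursion_weight P e e)) UNIV"
    by (simp add: excursion_mass_def emeasure_density)
  also have "\<dots> = emeasure (markov_measure P e) (return_word e -` UNIV \<inter> space (markov_measure P e))"
    unfolding distr_return_word[OF assms, symmetric] by (rule emeasure_distr) auto
  finally show ?thesis
    using emeasure_space_1 by simp
qed

subsection \<open>Invariant families of measures\<close>

primrec word_map :: "('e \<Rightarrow> 'x \<Rightarrow> 'x) \<Rightarrow> 'e list \<Rightarrow> 'x \<Rightarrow> 'x" where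
  "word_map t [] x = x"
| "word_map t (a # w) x = t a (word_map t w x)"

text \<open>The maps \<open>t a\<close> will be the actions of the \<open>g a\<close>, so that
  \<open>word_map t w\<close> is the action of the product along \<open>w\<close>.\<close>

locale action_chain =
  fixes P :: "'e::countable \<Rightarrow> 'e pmf" and B :: "'x measure" and t :: "'e \<Rightarrow> 'x \<Rightarrow> 'x"
  assumes measurable_t [measurable]: "\<And>a. t a \<in> measurable B B"
begin

definition pull :: "'e \<Rightarrow> 'x set \<Rightarrow> 'x set" where
  "pull a A = t a -` A \<inter> space B"

text \<open>The measure written \<open>K\<^sub>f(\<eta>)\<close> in the overview.\<close>

definition excursion_measure :: "'e \<Rightarrow> 'x measure \<Rightarrow> 'e \<Rightarrow> 'x measure" where
  "excursion_measure e \<eta> f =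
     weighted_sum_measure B (excursion_weight P e f) (\<lambda>w. distr \<eta> B (word_map t w))"

text \<open>The measures are not normalised: in the application \<open>m f\<close> carries the mass
  that the stationary distribution gives to \<open>f\<close>.\<close>

definition invariant_family :: "('e \<Rightarrow> 'x measure) \<Rightarrow> bool" where
  "invariant_family m \<longleftrightarrow> (\<forall>f. sets (m f) = sets B) \<and>
     (\<forall>f. \<forall>A\<in>sets B. emeasure (m f) A =
        (\<integral>\<^sup>+a. ennreal (pmf (P a) f) * emeasure (distr (m a) B (t a)) A \<partial>count_space UNIV))"

lemma measurable_word_map [measurable]: "word_map t w \<in> measurable B B"
  by (induction w) simp_all

lemma pull_sets [simp]: "A \<in> sets B \<Longrightarrow> pull a A \<in> sets B"
  unfolding pull_def by (rule measurable_sets[OF measurable_t])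

lemma pull_word_sets [simp]: "A \<in> sets B \<Longrightarrow> pull_word pull w A \<in> sets B"
  by (induction w arbitrary: A) auto

lemma pull_space [simp]: "pull a (space B) = space B"
  unfolding pull_def using measurable_space[OF measurable_t] by auto

lemma emeasure_distr_t:
  assumes "sets \<eta> = sets B" "A \<in> sets B"
  shows "emeasure (distr \<eta> B (t a)) A = emeasure \<eta> (pull a A)"
proof -
  have "t a \<in> measurable \<eta> B"
    using assms(1) by (simp cong: measurable_cong_sets)
  then show ?thesis
    using assms sets_eq_imp_space_eq[OF assms(1)] by (simp add: emeasure_distr pull_def)
qed

lemma emeasure_distr_word_map:
  assumes "sets \<eta> = sets B" "A \<in> sets B"
  shows "emeasure (distr \<eta> B (word_map t w)) A = emeasure \<eta> (pull_word pull w A)"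
  using assms(2)
proof (induction w arbitrary: A)
  case Nil
  have "distr \<eta> B (word_map t []) = distr \<eta> \<eta> (\<lambda>x. x)"
    using assms(1) by (intro distr_cong) auto
  then have "distr \<eta> B (word_map t []) = \<eta>"
    by (simp only: distr_id)
  then show ?case by (simp del: word_map.simps)
next
  case (Cons a w)
  have w: "word_map t w \<in> measurable \<eta> B"
    using assms(1) by (simp cong: measurable_cong_sets)
  have "distr \<eta> B (word_map t (a # w)) = distr (distr \<eta> B (word_map t w)) B (t a)"
    by (subst distr_distr[OF measurable_t w]) (rule distr_cong, auto)
  then have "emeasure (distr \<eta> B (word_map t (a # w))) A = emeasure (distr \<eta> B (word_map t w)) (pull a A)"
    using Cons.prems by (simp add: emeasure_distr_t)
  then show ?case
    using Cons by (simp del: word_map.simps)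
qed

lemma sets_excursion_measure [simp]: "sets (excursion_measure e \<eta> f) = sets B"
  by (simp add: excursion_measure_def)

lemma emeasure_excursion_measure:
  assumes "A \<in> sets B"
  shows "emeasure (excursion_measure e \<eta> f) A =
    (\<integral>\<^sup>+w. excursion_weight P e f w * emeasure (distr \<eta> B (word_map t w)) A \<partial>count_space UNIV)"
  unfolding excursion_measure_def using assms by (intro emeasure_weighted_sum_measure) auto

lemma emeasure_excursion_measure_eq_sum:
  assumes "sets \<eta> = sets B" "A \<in> sets B"
  shows "emeasure (excursion_measure e \<eta> f) A = excursion_sum P e pull (emeasure \<eta>) f A"
  using assms by (simp add: emeasure_excursion_measure emeasure_distr_word_map excursion_sum_def)

lemma emeasure_excursion_measure_space:
  assumes "sets \<eta> = sets B"
  shows "emeasure (excursion_measure e \<eta> f) (space B) = emeasure \<eta> (space B) * excursion_mass P e f"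
proof -
  have "pull_word pull w (space B) = space B" for w
    by (induction w) auto
  then show ?thesis
    using assms
    by (simp add: emeasure_excursion_measure_eq_sum excursion_sum_def excursion_mass_def
        nn_integral_multc mult.commute[of _ "emeasure \<eta> (space B)"] nn_integral_cmult)
qed

lemma invariant_familyD:
  assumes "invariant_family m"
  shows "sets (m f) = sets B"
    and "A \<in> sets B \<Longrightarrow>
      emeasure (m f) A = (\<integral>\<^sup>+a. ennreal (pmf (P a) f) * emeasure (m a) (pull a A) \<partial>count_space UNIV)"
  using assms by (auto simp: invariant_family_def emeasure_distr_t)

text \<open>If the invariance sum vanishes on a set, so does each of its terms. Hence null sets pull
  back to null sets along every transition of positive probability, and so along paths.\<close>

lemma invariant_family_null_path:
  assumes m: "invariant_family m" and "A \<in> sets B" "emeasure (m f) A = 0" "path_to P f w" "w \<noteq> []"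
  shows "emeasure (distr (m (last w)) B (word_map t w)) A = 0"
proof -
  have "emeasure (m (last w)) (pull_word pull w A) = 0"
    using assms(2-)
  proof (induction w arbitrary: f A)
    case (Cons a w)
    have "(\<integral>\<^sup>+a. ennreal (pmf (P a) f) * emeasure (m a) (pull a A) \<partial>count_space UNIV) = 0"
      using Cons.prems invariant_familyD(2)[OF m, of A f] by simp
    then have "ennreal (pmf (P a) f) * emeasure (m a) (pull a A) = 0"
      by (simp add: nn_integral_0_iff_AE AE_count_space)
    then have "emeasure (m a) (pull a A) = 0"
      using Cons.prems by auto
    then show ?case
      using Cons.prems Cons.IH[of "pull a A" a] by auto
  qed simp
  then show ?thesis
    using assms by (simp add: emeasure_distr_word_map invariant_familyD(1)[OF m])
qed

text \<open>The total masses form an invariant scalar family, because every \<open>pull a\<close>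
  fixes the whole space.\<close>

lemma invariant_family_mass:
  assumes m: "invariant_family m" and fin: "\<And>f. emeasure (m f) (space B) \<noteq> \<infinity>"
    and mass: "excursion_mass P e e = 1"
    and paths: "\<And>f. \<exists>w. w \<noteq> [] \<and> last w = f \<and> path_to P e w"
  shows "emeasure (m f) (space B) = emeasure (m e) (space B) * excursion_mass P e f"
proof (rule invariant_eq_excursion_mass[where a = "\<lambda>f. emeasure (m f) (space B)", OF _ fin mass paths])
  show "emeasure (m f) (space B) =
      (\<integral>\<^sup>+x. ennreal (pmf (P x) f) * emeasure (m x) (space B) \<partial>count_space UNIV)" for f
    using invariant_familyD(2)[OF m, of "space B" f] by simp
qed

text \<open>The excursion measure lies below \<open>m f\<close> on every set and has the same finite
  total mass; passing to complements gives the reverse inequality.\<close>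

lemma invariant_family_eq_excursion_measure:
  assumes m: "invariant_family m" and fin: "\<And>f. emeasure (m f) (space B) \<noteq> \<infinity>"
    and mass: "excursion_mass P e e = 1"
    and paths: "\<And>f. \<exists>w. w \<noteq> [] \<and> last w = f \<and> path_to P e w"
  shows "excursion_measure e (m e) f = m f"
proof (rule measure_eqI)
  let ?K = "excursion_measure e (m e) f"
  note sets_m = invariant_familyD(1)[OF m]
  have le: "emeasure ?K A \<le> emeasure (m f) A" if "A \<in> sets B" for A
    unfolding emeasure_excursion_measure_eq_sum[OF sets_m that]
    by (rule excursion_sum_le[where m = "\<lambda>f. emeasure (m f)" and \<S> = "sets B"])
       (simp, rule invariant_familyD(2)[OF m], assumption, rule that)
  have total: "emeasure ?K (space B) = emeasure (m f) (space B)"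
    unfolding emeasure_excursion_measure_space[OF sets_m] by (rule invariant_family_mass[OF assms, symmetric])
  fix A assume "A \<in> sets ?K"
  then have A: "A \<in> sets B" by simp
  have compl: "emeasure M A = emeasure M (space B) - emeasure M (space B - A)"
    if M: "sets M = sets B" "emeasure M (space B) \<noteq> \<infinity>" for M
  proof -
    have sp: "space M = space B"
      by (rule sets_eq_imp_space_eq[OF M(1)])
    have "emeasure M (space B - A) \<le> emeasure M (space B)"
      using M by (intro emeasure_mono) auto
    then have "emeasure M (space B - A) \<noteq> \<infinity>"
      using M(2) by (auto simp: top_unique)
    moreover have "space B - (space B - A) = A"
      using sets.sets_into_space[OF A] by auto
    ultimately show ?thesis
      using emeasure_compl[of "space B - A" M] A M(1) sp by simp
  qed
  have "emeasure (m f) A = emeasure (m f) (space B) - emeasure (m f) (space B - A)"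
    by (rule compl[OF sets_m fin])
  also have "\<dots> \<le> emeasure ?K (space B) - emeasure ?K (space B - A)"
    unfolding total by (rule ennreal_minus_mono[OF order_refl le]) (use A in auto)
  also have "\<dots> = emeasure ?K A"
    by (rule compl[symmetric]) (simp_all add: total fin[simplified])
  finally show "emeasure ?K A = emeasure (m f) A"
    using le[OF A] by (rule antisym[rotated])
qed (simp add: invariant_familyD(1)[OF m])

text \<open>In the one-step recursion the state \<open>e\<close> contributes \<eta> itself, where
  invariance asks for the excursion measure at \<open>e\<close>. The hypothesis \<open>fixed\<close>
  says that the two coincide.\<close>

lemma invariant_family_excursion_measure:
  assumes \<eta>: "sets \<eta> = sets B" and fixed: "excursion_measure e \<eta> e = \<eta>"
  shows "invariant_family (excursion_measure e \<eta>)"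
  unfolding invariant_family_def
proof (intro conjI allI ballI)
  fix f A assume A: "A \<in> sets B"
  have "emeasure (excursion_measure e \<eta> f) A = (\<integral>\<^sup>+a. ennreal (pmf (P a) f) *
      (if a = e then emeasure \<eta> (pull a A) else excursion_sum P e pull (emeasure \<eta>) a (pull a A))
      \<partial>count_space UNIV)"
    unfolding emeasure_excursion_measure_eq_sum[OF \<eta> A] by (rule excursion_sum_step)
  also have "\<dots> = (\<integral>\<^sup>+a. ennreal (pmf (P a) f) *
      emeasure (distr (excursion_measure e \<eta> a) B (t a)) A \<partial>count_space UNIV)"
  proof (rule nn_integral_cong)
    fix a
    have "emeasure (distr (excursion_measure e \<eta> a) B (t a)) A = emeasure (excursion_measure e \<eta> a) (pull a A)"
      using A by (simp add: emeasure_distr_t)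
    also have "\<dots> = (if a = e then emeasure \<eta> (pull a A) else excursion_sum P e pull (emeasure \<eta>) a (pull a A))"
    proof (cases "a = e")
      case True
      then show ?thesis by (simp add: fixed)
    next
      case False
      then show ?thesis using A by (simp add: emeasure_excursion_measure_eq_sum[OF \<eta>])
    qed
    finally show "ennreal (pmf (P a) f) * (if a = e then emeasure \<eta> (pull a A)
        else excursion_sum P e pull (emeasure \<eta>) a (pull a A)) =
        ennreal (pmf (P a) f) * emeasure (distr (excursion_measure e \<eta> a) B (t a)) A"
      by simp
  qed
  finally show "emeasure (excursion_measure e \<eta> f) A = (\<integral>\<^sup>+a. ennreal (pmf (P a) f) *
      emeasure (distr (excursion_measure e \<eta> a) B (t a)) A \<partial>count_space UNIV)" .
qed simp

text \<open>Serves both for rescaling, with second coefficient 0, and for lifting convex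
  combinations.\<close>

lemma excursion_measure_linear:
  assumes sets: "sets \<eta> = sets B" "sets \<eta>1 = sets B" "sets \<eta>2 = sets B"
    and eq: "\<And>A. A \<in> sets B \<Longrightarrow> emeasure \<eta> A = c1 * emeasure \<eta>1 A + c2 * emeasure \<eta>2 A"
    and A: "A \<in> sets B"
  shows "emeasure (excursion_measure e \<eta> f) A =
    c1 * emeasure (excursion_measure e \<eta>1 f) A + c2 * emeasure (excursion_measure e \<eta>2 f) A"
  using A sets
  by (simp add: emeasure_excursion_measure_eq_sum excursion_sum_def eq[OF pull_word_sets]
        distrib_left nn_integral_add mult.left_commute[of _ c1] mult.left_commute[of _ c2] nn_integral_cmult)

lemma invariant_family_scale:
  assumes m: "invariant_family m" and m': "\<And>f. sets (m' f) = sets B"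
    and eq: "\<And>f A. A \<in> sets B \<Longrightarrow> emeasure (m' f) A = c * emeasure (m f) A"
  shows "invariant_family m'"
  unfolding invariant_family_def
proof (intro conjI allI ballI)
  fix f A assume A: "A \<in> sets B"
  have "emeasure (m' f) A = c * (\<integral>\<^sup>+a. ennreal (pmf (P a) f) * emeasure (m a) (pull a A) \<partial>count_space UNIV)"
    unfolding eq[OF A] by (subst invariant_familyD(2)[OF m A]) simp
  also have "\<dots> = (\<integral>\<^sup>+a. c * (ennreal (pmf (P a) f) * emeasure (m a) (pull a A)) \<partial>count_space UNIV)"
    by (rule nn_integral_cmult[symmetric]) simp
  also have "\<dots> = (\<integral>\<^sup>+a. ennreal (pmf (P a) f) * emeasure (distr (m' a) B (t a)) A \<partial>count_space UNIV)"
    using A by (intro nn_integral_cong) (simp add: emeasure_distr_t m' eq mult.left_commute)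
  finally show "emeasure (m' f) A =
      (\<integral>\<^sup>+a. ennreal (pmf (P a) f) * emeasure (distr (m' a) B (t a)) A \<partial>count_space UNIV)" .
qed (rule m')

section \<open>Measures on pairs of a state and a point, and stationarity read on slices\<close>

definition kernel :: "'e \<times> 'x \<Rightarrow> ('e \<times> 'x) measure" where
  "kernel = (\<lambda>(a, x). measure_pmf (P a) \<Otimes>\<^sub>M return B (t a x))"

abbreviation "S \<equiv> count_space (UNIV :: 'e set) \<Otimes>\<^sub>M B"

text \<open>The measure \<open>m\<^sub>f\<close> of the overview: the indicator density restricts
  \<nu> to the fibre over \<open>f\<close>, which is then projected to the second factor.\<close>

definition slice :: "('e \<times> 'x) measure \<Rightarrow> 'e \<Rightarrow> 'x measure" where
  "slice \<nu> f = distr (density \<nu> (indicator ({f} \<times> space B))) B snd"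

lemma sets_slice [simp]: "sets (slice \<nu> f) = sets B"
  by (simp add: slice_def)

lemma emeasure_slice:
  assumes \<nu>: "sets \<nu> = sets S" and A: "A \<in> sets B"
  shows "emeasure (slice \<nu> f) A = emeasure \<nu> ({f} \<times> A)"
proof -
  note [measurable_cong] = \<nu>
  have [measurable]: "{f} \<times> space B \<in> sets \<nu>" "{f} \<times> A \<in> sets \<nu>"
    using A by (auto simp: \<nu>)
  have sp: "space \<nu> = UNIV \<times> space B"
    using sets_eq_imp_space_eq[OF \<nu>] by (simp add: space_pair_measure)
  have "snd \<in> measurable (density \<nu> (indicator ({f} \<times> space B))) B"
    by measurable
  then have "emeasure (slice \<nu> f) A =
      emeasure (density \<nu> (indicator ({f} \<times> space B))) (snd -` A \<inter> space \<nu>)"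
    unfolding slice_def using A by (simp add: emeasure_distr)
  also have "snd -` A \<inter> space \<nu> = UNIV \<times> A"
    using sets.sets_into_space[OF A] by (auto simp: sp)
  also have "emeasure (density \<nu> (indicator ({f} \<times> space B))) (UNIV \<times> A) =
      (\<integral>\<^sup>+z. indicator ({f} \<times> space B) z * indicator (UNIV \<times> A) z \<partial>\<nu>)"
    by (rule emeasure_density) (use A in \<open>auto simp: \<nu>\<close>)
  also have "\<dots> = (\<integral>\<^sup>+z. indicator ({f} \<times> A) z \<partial>\<nu>)"
    using sets.sets_into_space[OF A] by (intro nn_integral_cong) (auto split: split_indicator)
  finally show ?thesis by simp
qed

lemma sets_section: "A \<in> sets S \<Longrightarrow> Pair f -` A \<in> sets B"
  by (rule sets_Pair1)

lemma indicator_eq_sum_slices: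
  "(indicator A z :: ennreal) = (\<integral>\<^sup>+f. indicator ({f} \<times> (Pair f -` A)) z \<partial>count_space UNIV)"
proof -
  have "(\<integral>\<^sup>+f. indicator ({f} \<times> (Pair f -` A)) z \<partial>count_space UNIV) =
      (\<integral>\<^sup>+f. indicator A z * indicator {fst z} f \<partial>count_space UNIV)"
    by (rule nn_integral_cong) (cases z, auto split: split_indicator)
  also have "\<dots> = indicator A z"
    by (simp add: nn_integral_count_space_finite flip: nn_integral_count_space_indicator)
  finally show ?thesis by simp
qed

lemma emeasure_eq_sum_slices:
  assumes \<nu>: "sets \<nu> = sets S" and A: "A \<in> sets S"
  shows "emeasure \<nu> A = (\<integral>\<^sup>+f. emeasure (slice \<nu> f) (Pair f -` A) \<partial>count_space UNIV)"
proof -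
  have s: "{f} \<times> (Pair f -` A) \<in> sets \<nu>" for f
    using sets_section[OF A] by (auto simp: \<nu>)
  have "emeasure \<nu> A = (\<integral>\<^sup>+z. indicator A z \<partial>\<nu>)"
    using A by (simp add: \<nu>)
  also have "\<dots> = (\<integral>\<^sup>+z. \<integral>\<^sup>+f. indicator ({f} \<times> (Pair f -` A)) z \<partial>count_space UNIV \<partial>\<nu>)"
    by (subst indicator_eq_sum_slices) simp
  also have "\<dots> = (\<integral>\<^sup>+f. \<integral>\<^sup>+z. indicator ({f} \<times> (Pair f -` A)) z \<partial>\<nu> \<partial>count_space UNIV)"
    using s by (intro nn_integral_count_space_nn_integral) auto
  also have "\<dots> = (\<integral>\<^sup>+f. emeasure (slice \<nu> f) (Pair f -` A) \<partial>count_space UNIV)"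
    using s by (simp add: emeasure_slice[OF \<nu> sets_section[OF A]])
  finally show ?thesis .
qed

lemma emeasure_kernel:
  assumes A: "A \<in> sets S" and x: "x \<in> space B"
  shows "emeasure (kernel (a, x)) A =
    (\<integral>\<^sup>+f. ennreal (pmf (P a) f) * indicator (Pair f -` A) (t a x) \<partial>count_space UNIV)"
proof -
  have tx: "t a x \<in> space B"
    using measurable_space[OF measurable_t x] .
  interpret R: prob_space "return B (t a x)"
    by (rule prob_space_return[OF tx])
  have "A \<in> sets (measure_pmf (P a) \<Otimes>\<^sub>M return B (t a x))"
    using A sets_pair_measure_cong[of "measure_pmf (P a)" "count_space UNIV" "return B (t a x)" B] by simp
  then have "emeasure (kernel (a, x)) A = (\<integral>\<^sup>+f. emeasure (return B (t a x)) (Pair f -` A) \<partial>measure_pmf (P a))"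
    unfolding kernel_def by (simp add: R.emeasure_pair_measure_alt)
  also have "\<dots> = (\<integral>\<^sup>+f. indicator (Pair f -` A) (t a x) \<partial>measure_pmf (P a))"
    using sets_section[OF A] by (intro nn_integral_cong) (simp add: emeasure_return)
  finally show ?thesis
    by (simp add: nn_integral_measure_pmf)
qed

text \<open>The kernel is written as a sum of indicators over the new state \<open>f\<close> and the
  old state \<open>a\<close>, and the sum is exchanged with the integral.\<close>

lemma nn_integral_kernel:
  assumes \<nu>: "sets \<nu> = sets S" and A: "A \<in> sets S"
  shows "(\<integral>\<^sup>+z. emeasure (kernel z) A \<partial>\<nu>) =
    (\<integral>\<^sup>+f. \<integral>\<^sup>+a. ennreal (pmf (P a) f) * emeasure (slice \<nu> a) (pull a (Pair f -` A))
      \<partial>count_space UNIV \<partial>count_space UNIV)"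
proof -
  have sp: "space \<nu> = UNIV \<times> space B"
    using sets_eq_imp_space_eq[OF \<nu>] by (simp add: space_pair_measure)
  have s: "{a} \<times> pull a (Pair f -` A) \<in> sets \<nu>" for a f
    using sets_section[OF A] by (auto simp: \<nu>)
  let ?I = "\<lambda>f a z. ennreal (pmf (P a) f) * indicator ({a} \<times> pull a (Pair f -` A)) z"
  have "emeasure (kernel z) A = (\<integral>\<^sup>+f. \<integral>\<^sup>+a. ?I f a z \<partial>count_space UNIV \<partial>count_space UNIV)"
    if z: "z \<in> space \<nu>" for z
  proof -
    obtain b x where bx: "z = (b, x)" "x \<in> space B"
      using z sp by auto
    have "(\<integral>\<^sup>+a. ?I f a z \<partial>count_space UNIV) = ennreal (pmf (P b) f) * indicator (Pair f -` A) (t b x)" for f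
    proof -
      have "(\<integral>\<^sup>+a. ?I f a z \<partial>count_space UNIV) =
          (\<integral>\<^sup>+a. ennreal (pmf (P b) f) * indicator (Pair f -` A) (t b x) * indicator {b} a \<partial>count_space UNIV)"
        using bx by (intro nn_integral_cong) (auto simp: pull_def split: split_indicator)
      also have "\<dots> = ennreal (pmf (P b) f) * indicator (Pair f -` A) (t b x)"
        by (simp add: nn_integral_count_space_finite flip: nn_integral_count_space_indicator)
      finally show ?thesis .
    qed
    then show ?thesis
      using bx by (simp add: emeasure_kernel[OF A])
  qed
  then have "(\<integral>\<^sup>+z. emeasure (kernel z) A \<partial>\<nu>) =
      (\<integral>\<^sup>+z. \<integral>\<^sup>+f. \<integral>\<^sup>+a. ?I f a z \<partial>count_space UNIV \<partial>count_space UNIV \<partial>\<nu>)"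
    by (rule nn_integral_cong)
  \<comment> \<open>The two sums are merged into one over pairs, so that a single exchange with the
    integral suffices.\<close>
  also have "\<dots> = (\<integral>\<^sup>+z. \<integral>\<^sup>+p. ?I (fst p) (snd p) z \<partial>count_space UNIV \<partial>\<nu>)"
    by (subst nn_integral_fst_count_space[symmetric]) simp
  also have "\<dots> = (\<integral>\<^sup>+p. \<integral>\<^sup>+z. ?I (fst p) (snd p) z \<partial>\<nu> \<partial>count_space UNIV)"
    using s by (intro nn_integral_count_space_nn_integral) auto
  also have "\<dots> = (\<integral>\<^sup>+f. \<integral>\<^sup>+a. \<integral>\<^sup>+z. ?I f a z \<partial>\<nu> \<partial>count_space UNIV \<partial>count_space UNIV)"
    by (subst nn_integral_fst_count_space[symmetric]) simp
  also have "\<dots> = (\<integral>\<^sup>+f. \<integral>\<^sup>+a. ennreal (pmf (P a) f) * emeasure (slice \<nu> a) (pull a (Pair f -` A))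
      \<partial>count_space UNIV \<partial>count_space UNIV)"
    using s by (intro nn_integral_cong)
      (simp add: nn_integral_cmult_indicator emeasure_slice[OF \<nu>] sets_section[OF A])
  finally show ?thesis .
qed

lemma stationary_iff_invariant_family:
  assumes \<nu>: "sets \<nu> = sets S"
  shows "(\<forall>A\<in>sets S. (\<integral>\<^sup>+z. emeasure (kernel z) A \<partial>\<nu>) = emeasure \<nu> A) \<longleftrightarrow> invariant_family (slice \<nu>)"
proof
  assume inv: "invariant_family (slice \<nu>)"
  show "\<forall>A\<in>sets S. (\<integral>\<^sup>+z. emeasure (kernel z) A \<partial>\<nu>) = emeasure \<nu> A"
  proof
    fix A assume A: "A \<in> sets S"
    show "(\<integral>\<^sup>+z. emeasure (kernel z) A \<partial>\<nu>) = emeasure \<nu> A"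
      unfolding nn_integral_kernel[OF \<nu> A] emeasure_eq_sum_slices[OF \<nu> A]
      by (rule nn_integral_cong, rule invariant_familyD(2)[OF inv, symmetric]) (rule sets_section[OF A])
  qed
next
  assume *: "\<forall>A\<in>sets S. (\<integral>\<^sup>+z. emeasure (kernel z) A \<partial>\<nu>) = emeasure \<nu> A"
  show "invariant_family (slice \<nu>)"
    unfolding invariant_family_def
  proof (intro conjI allI ballI)
    fix f A assume A: "A \<in> sets B"
    \<comment> \<open>A test set over the single state \<open>f\<close> isolates the equation for
      \<open>f\<close>, since all its other sections are empty.\<close>
    have fA: "{f} \<times> A \<in> sets S"
      using A by auto
    have sec: "Pair f' -` ({f} \<times> A) = (if f' = f then A else {})" for f'
      by auto
    have "emeasure (slice \<nu> f) A = emeasure \<nu> ({f} \<times> A)"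
      by (rule emeasure_slice[OF \<nu> A])
    also have "\<dots> = (\<integral>\<^sup>+f'. \<integral>\<^sup>+a. ennreal (pmf (P a) f') *
        emeasure (slice \<nu> a) (pull a (if f' = f then A else {})) \<partial>count_space UNIV \<partial>count_space UNIV)"
      using * fA nn_integral_kernel[OF \<nu> fA] unfolding sec by simp
    also have "\<dots> = (\<integral>\<^sup>+f'. (\<integral>\<^sup>+a. ennreal (pmf (P a) f) * emeasure (slice \<nu> a) (pull a A)
        \<partial>count_space UNIV) * indicator {f} f' \<partial>count_space UNIV)"
      by (rule nn_integral_cong) (auto simp: pull_def split: split_indicator)
    also have "\<dots> = (\<integral>\<^sup>+a. ennreal (pmf (P a) f) * emeasure (slice \<nu> a) (pull a A) \<partial>count_space UNIV)"
      by (simp add: nn_integral_count_space_finite flip: nn_integral_count_space_indicator)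
    finally show "emeasure (slice \<nu> f) A = (\<integral>\<^sup>+a. ennreal (pmf (P a) f) *
        emeasure (distr (slice \<nu> a) B (t a)) A \<partial>count_space UNIV)"
      using A by (simp add: emeasure_distr_t)
  qed simp
qed

text \<open>The sum over \<open>f\<close> of \<open>c f\<close> times the product of the point mass
  at \<open>f\<close> with \<open>m f\<close>; its slices are the \<open>m f\<close>, rescaled by
  \<open>c f\<close>.\<close>

definition assemble :: "('e \<Rightarrow> ennreal) \<Rightarrow> ('e \<Rightarrow> 'x measure) \<Rightarrow> ('e \<times> 'x) measure" where
  "assemble c m = weighted_sum_measure S c (\<lambda>f. distr (m f) S (Pair f))"

lemma sets_assemble [simp]: "sets (assemble c m) = sets S"
  by (simp add: assemble_def)

lemma emeasure_distr_Pair: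
  assumes m: "sets \<eta> = sets B" and A: "A \<in> sets S"
  shows "emeasure (distr \<eta> S (Pair f)) A = emeasure \<eta> (Pair f -` A)"
proof -
  have "Pair f \<in> measurable \<eta> S"
    using m by (simp cong: measurable_cong_sets)
  moreover have "Pair f -` A \<subseteq> space \<eta>"
    using sets.sets_into_space[OF sets_section[OF A]] sets_eq_imp_space_eq[OF m] by auto
  ultimately show ?thesis
    using A by (simp add: emeasure_distr Int_absorb2)
qed

lemma emeasure_assemble:
  assumes m: "\<And>f. sets (m f) = sets B" and A: "A \<in> sets S"
  shows "emeasure (assemble c m) A = (\<integral>\<^sup>+f. c f * emeasure (m f) (Pair f -` A) \<partial>count_space UNIV)"
  unfolding assemble_def using A
  by (subst emeasure_weighted_sum_measure) (auto simp: emeasure_distr_Pair[OF m])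

lemma emeasure_slice_assemble:
  assumes m: "\<And>f. sets (m f) = sets B" and A: "A \<in> sets B"
  shows "emeasure (slice (assemble c m) f) A = c f * emeasure (m f) A"
proof -
  have fA: "{f} \<times> A \<in> sets S"
    using A by auto
  have "emeasure (slice (assemble c m) f) A =
      (\<integral>\<^sup>+f'. c f' * emeasure (m f') (Pair f' -` ({f} \<times> A)) \<partial>count_space UNIV)"
    using A fA by (simp add: emeasure_slice emeasure_assemble[OF m])
  also have "\<dots> = (\<integral>\<^sup>+f'. c f * emeasure (m f) A * indicator {f} f' \<partial>count_space UNIV)"
  proof (rule nn_integral_cong)
    fix f'
    have "Pair f' -` ({f} \<times> A) = (if f' = f then A else {})"
      by auto
    then show "c f' * emeasure (m f') (Pair f' -` ({f} \<times> A)) = c f * emeasure (m f) A * indicator {f} f'"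
      by (auto split: split_indicator)
  qed
  also have "\<dots> = c f * emeasure (m f) A"
    by (simp add: nn_integral_count_space_finite flip: nn_integral_count_space_indicator)
  finally show ?thesis .
qed

end

subsection \<open>The renewal measure\<close>

lemma space_borel_of [simp]: "space (borel_of X) = topspace X"
  by (simp add: borel_of_def space_measure_of_conv)

lemma openin_sets_borel_of: "openin X U \<Longrightarrow> U \<in> sets (borel_of X)"
  unfolding borel_of_def using openin_subset by (intro in_measure_of) auto

lemma closedin_sets_borel_of:
  assumes "closedin X C"
  shows "C \<in> sets (borel_of X)"
proof -
  have "topspace X - (topspace X - C) \<in> sets (borel_of X)"
    using assms sets.top[of "borel_of X"] by (intro sets.Diff openin_sets_borel_of) auto
  then show ?thesis
    using closedin_subset[OF assms] by (simp add: double_diff)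
qed

lemma measurable_continuous_map:
  assumes f: "continuous_map X Y f"
  shows "f \<in> measurable (borel_of X) (borel_of Y)"
  unfolding borel_of_def[of Y]
proof (rule measurable_measure_of)
  show "f \<in> space (borel_of X) \<rightarrow> topspace Y"
    using continuous_map_image_subset_topspace[OF f] by auto
  show "f -` U \<inter> space (borel_of X) \<in> sets (borel_of X)" if "U \<in> {U. openin Y U}" for U
  proof -
    have "f -` U \<inter> space (borel_of X) = {x \<in> topspace X. f x \<in> U}"
      by auto
    then show ?thesis
      using that f by (simp add: openin_continuous_map_preimage openin_sets_borel_of)
  qed
qed (use openin_subset in auto)

locale coded_group_chain = group G for G :: "('g, 'm) monoid_scheme" (structure) +
  fixes T :: "'g topology" and X :: "'x topology" and act :: "'g \<Rightarrow> 'x \<Rightarrow> 'x"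
    and g :: "'e::countable \<Rightarrow> 'g" and P :: "'e \<Rightarrow> 'e pmf"
  assumes topspace_eq: "topspace T = carrier G"
    and Hausdorff: "Hausdorff_space T"
    and action: "continuous_group_action G T X act"
    and coding: "\<And>a. g a \<in> carrier G"
begin

abbreviation "\<mu> \<equiv> renewal_measure G T g P"

sublocale act: group_action G "topspace X" act
  using action by (simp add: continuous_group_action_def)

lemma measurable_act:
  assumes h: "h \<in> carrier G"
  shows "act h \<in> measurable (borel_of X) (borel_of X)"
proof (rule measurable_continuous_map)
  have "continuous_map X (prod_topology T X) (\<lambda>x. (h, x))"
    using h by (simp add: continuous_map_pairwise comp_def topspace_eq)
  moreover have "continuous_map (prod_topology T X) X (\<lambda>(h, x). act h x)"
    using action by (simp add: continuous_group_action_def)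
  ultimately have "continuous_map X X ((\<lambda>(h, x). act h x) \<circ> (\<lambda>x. (h, x)))"
    by (rule continuous_map_compose)
  then show "continuous_map X X (act h)"
    by (simp add: comp_def)
qed

sublocale action_chain P "borel_of X" "\<lambda>a. act (g a)"
  by standard (rule measurable_act[OF coding])

lemma word_prod_closed [simp]: "word_prod G g w \<in> carrier G"
  by (induction w) (auto simp: word_prod_def coding)

lemma word_prod_Nil [simp]: "word_prod G g [] = \<one>"
  by (simp add: word_prod_def)

lemma word_prod_Cons [simp]: "word_prod G g (a # w) = g a \<otimes> word_prod G g w"
  by (simp add: word_prod_def)

lemma word_prod_append: "word_prod G g (v @ w) = word_prod G g v \<otimes> word_prod G g w"
  by (induction v) (auto simp: coding m_assoc)

lemma act_word_prod:
  assumes "x \<in> topspace X"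
  shows "act (word_prod G g w) x = word_map (\<lambda>a. act (g a)) w x"
proof (induction w)
  case Nil
  \<comment> \<open>In a \<open>group_action\<close> the unit acts as the identity restricted to the
    carrier set, so the claim uses that \<open>x\<close> is a point of the space.\<close>
  then show ?case
    using assms act.id_eq_one by (metis restrict_apply' word_map.simps(1) word_prod_Nil)
next
  case (Cons a w)
  then show ?case
    using assms by (simp add: act.composition_rule coding)
qed

lemma pushforward_word_prod:
  assumes "sets \<eta> = sets (borel_of X)"
  shows "pushforward X act (word_prod G g w) \<eta> = distr \<eta> (borel_of X) (word_map (\<lambda>a. act (g a)) w)"
  unfolding pushforward_def
  using sets_eq_imp_space_eq[OF assms] by (intro distr_cong) (auto simp: act_word_prod)

lemma singleton_sets_borel_of: "h \<in> carrier G \<Longrightarrow> {h} \<in> sets (borel_of T)"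
  using Hausdorff by (intro closedin_sets_borel_of) (simp add: closedin_Hausdorff_singleton topspace_eq)

text \<open>The renewal product depends on the trajectory only through the return word, whose law is
  known.\<close>

lemma renewal_measure_eq:
  assumes "positive_recurrent_chain P"
  shows "\<mu> e = distr (density (count_space UNIV) (excursion_weight P e e)) (borel_of T) (word_prod G g)"
proof -
  have wp: "word_prod G g \<in> measurable (count_space UNIV) (borel_of T)"
    by (simp add: topspace_eq)
  have "\<mu> e = distr (markov_measure P e) (borel_of T) (word_prod G g \<circ> return_word e)"
    unfolding renewal_measure_def by (rule distr_cong) (auto simp: renewal_product_eq)
  also have "\<dots> = distr (distr (markov_measure P e) (count_space UNIV) (return_word e)) (borel_of T) (word_prod G g)"
    by (rule distr_distr[symmetric, OF wp measurable_return_word])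
  finally show ?thesis
    unfolding distr_return_word[OF assms] .
qed

text \<open>The renewal measure is carried by the countable set of values of \<open>word_prod\<close>, so every \<open>F\<close> is
  measurable up to a null set.\<close>

lemma nn_integral_renewal_measure:
  assumes "positive_recurrent_chain P"
  shows "(\<integral>\<^sup>+h. F h \<partial>\<mu> e) =
    (\<integral>\<^sup>+w. excursion_weight P e e w * F (word_prod G g w) \<partial>count_space UNIV)"
proof -
  let ?D = "density (count_space UNIV) (excursion_weight P e e)"
  let ?C = "range (word_prod G g :: 'e list \<Rightarrow> 'g)"
  have wp: "word_prod G g \<in> measurable ?D (borel_of T)"
    by (simp add: topspace_eq)
  have C: "countable ?C" "?C \<subseteq> carrier G"
    by auto
  have single: "{h} \<in> sets (borel_of T)" if "h \<in> ?C" for h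
    using that C singleton_sets_borel_of by auto
  have [measurable]: "?C \<in> sets (borel_of T)"
    by (rule sets.countable[OF single C(1)])
  \<comment> \<open>Cut off outside \<open>?C\<close>, the function differs from 0 at countably many
    points only, and their singletons are measurable.\<close>
  have meas: "(\<lambda>h. F h * indicator ?C h) \<in> borel_measurable (borel_of T)"
    by (rule measurable_discrete_difference[where f = "\<lambda>_. 0" and X = ?C])
       (use C single in \<open>auto split: split_indicator\<close>)
  have "AE h in distr ?D (borel_of T) (word_prod G g). h \<in> ?C"
  proof (subst AE_distr_iff[OF wp])
    have "{h \<in> space (borel_of T). h \<in> ?C} = ?C"
      using C(2) by (auto simp: topspace_eq)
    then show "{h \<in> space (borel_of T). h \<in> ?C} \<in> sets (borel_of T)"
      by simp
  qed simp
  then have "(\<integral>\<^sup>+h. F h \<partial>distr ?D (borel_of T) (word_prod G g)) =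
      (\<integral>\<^sup>+h. F h * indicator ?C h \<partial>distr ?D (borel_of T) (word_prod G g))"
    by (intro nn_integral_cong_AE) (auto elim!: eventually_mono split: split_indicator)
  also have "\<dots> = (\<integral>\<^sup>+w. F (word_prod G g w) * indicator ?C (word_prod G g w) \<partial>?D)"
    by (rule nn_integral_distr[OF wp]) (simp add: meas)
  also have "\<dots> = (\<integral>\<^sup>+w. excursion_weight P e e w * F (word_prod G g w) \<partial>count_space UNIV)"
    by (simp add: nn_integral_density)
  finally show ?thesis
    unfolding renewal_measure_eq[OF assms] .
qed

text \<open>Averaging push-forwards of \<eta> over the renewal measure is the excursion measure from
  \<open>e\<close> back to \<open>e\<close>, so stationarity is a fixed-point equation.\<close>

lemma mu_stationary_iff:
  assumes "positive_recurrent_chain P"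
  shows "\<eta> \<in> mu_stationary X act (\<mu> e) \<longleftrightarrow>
    prob_space \<eta> \<and> sets \<eta> = sets (borel_of X) \<and> excursion_measure e \<eta> e = \<eta>"
proof (cases "sets \<eta> = sets (borel_of X)")
  case True
  have "(\<integral>\<^sup>+h. emeasure (pushforward X act h \<eta>) A \<partial>\<mu> e) = emeasure (excursion_measure e \<eta> e) A"
    if "A \<in> sets (borel_of X)" for A
    using that by (simp add: nn_integral_renewal_measure[OF assms] pushforward_word_prod[OF True]
        emeasure_excursion_measure)
  then have "(\<forall>A\<in>sets (borel_of X). (\<integral>\<^sup>+h. emeasure (pushforward X act h \<eta>) A \<partial>\<mu> e) = emeasure \<eta> A) \<longleftrightarrow>
      (\<forall>A\<in>sets (borel_of X). emeasure (excursion_measure e \<eta> e) A = emeasure \<eta> A)"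
    by simp
  also have "\<dots> \<longleftrightarrow> excursion_measure e \<eta> e = \<eta>"
    using True by (auto intro: measure_eqI)
  finally show ?thesis
    using True by (simp add: mu_stationary_def prob_measures_on_def)
qed (simp add: mu_stationary_def prob_measures_on_def)

section \<open>Loops and the renewal semigroup\<close>

lemma return_word_in_support:
  assumes "positive_recurrent_chain P"
    and w: "path_to P e w" "w \<noteq> []" "last w = e" "e \<notin> set (butlast w)"
  shows "word_prod G g w \<in> measure_support T (\<mu> e)"
  unfolding measure_support_def
proof (intro CollectI conjI allI impI)
  show "word_prod G g w \<in> topspace T"
    by (simp add: topspace_eq)
  fix U assume U: "openin T U \<and> word_prod G g w \<in> U"
  let ?D = "density (count_space UNIV) (excursion_weight P e e)"
  \<comment> \<open>The word \<open>w\<close> alone has positive probability as a return word, so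
    its product is an atom of the renewal measure and every neighbourhood \<open>U\<close> is
    charged.\<close>
  have "0 < excursion_weight P e e w"
    using w path_weight_pos[OF w(1-3)] by (simp add: excursion_weight_eq)
  also have "\<dots> = emeasure ?D {w}"
    by (simp add: emeasure_density nn_integral_count_space_finite flip: nn_integral_count_space_indicator)
  also have "\<dots> \<le> emeasure ?D (word_prod G g -` U \<inter> space ?D)"
    using U by (intro emeasure_mono) auto
  also have "\<dots> = emeasure (\<mu> e) U"
    unfolding renewal_measure_eq[OF assms(1)]
    by (rule emeasure_distr[symmetric]) (use U in \<open>auto simp: topspace_eq intro: openin_sets_borel_of\<close>)
  finally show "0 < emeasure (\<mu> e) U" .
qed

lemma loop_in_renewal_semigroup:
  assumes rec: "positive_recurrent_chain P"
    and "path_to P e w" "w \<noteq> []" "last w = e"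
  shows "word_prod G g w \<in> renewal_semigroup G T g P e"
  using assms(2-)
proof (induction w rule: length_induct)
  case (1 w)
  let ?R = "renewal_semigroup G T g P e"
  have supp: "measure_support T (\<mu> e) \<subseteq> ?R"
    by (auto simp: renewal_semigroup_def closed_subsemigroup_generated_def)
  have mult: "a \<otimes> b \<in> ?R" if "a \<in> ?R" "b \<in> ?R" for a b
    using that unfolding renewal_semigroup_def closed_subsemigroup_generated_def by blast
  show ?case
  proof (cases "e \<in> set (butlast w)")
    case False
    then show ?thesis
      using return_word_in_support[OF rec] supp "1.prems" by blast
  next
    case True
    \<comment> \<open>A visit to \<open>e\<close> after time 0 cuts the loop into two shorter loops
      at \<open>e\<close>: \<open>v @ [e]\<close> runs first, then \<open>u @ [e]\<close>. Without
      such a visit the loop is a possible return word.\<close>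
    then obtain u v where uv: "butlast w = u @ e # v"
      by (auto simp: in_set_conv_decomp)
    then have w: "w = (u @ [e]) @ (v @ [e])"
      using append_butlast_last_id[OF "1.prems"(2)] "1.prems"(3) by simp
    have "path_to P e (u @ [e])" "path_to P e (v @ [e])"
      using "1.prems"(1) unfolding w path_to_append[of P e "u @ [e]"] by simp_all
    moreover have "length (u @ [e]) < length w" "length (v @ [e]) < length w"
      unfolding w by simp_all
    ultimately have "word_prod G g (u @ [e]) \<in> ?R" "word_prod G g (v @ [e]) \<in> ?R"
      using "1.IH" by (metis append_is_Nil_conv last_snoc not_Cons_self2)+
    then show ?thesis
      unfolding w word_prod_append[of "u @ [e]"] by (rule mult)
  qed
qed

end

section \<open>The conditional measures of a stationary measure\<close>

locale stationary_action_chain = coded_group_chain G T X act g P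
  for G :: "('g, 'm) monoid_scheme" (structure) and T :: "'g topology" and X :: "'x topology"
    and act :: "'g \<Rightarrow> 'x \<Rightarrow> 'x" and g :: "'e::countable \<Rightarrow> 'g" and P :: "'e \<Rightarrow> 'e pmf" +
  fixes \<pi> :: "'e pmf" and \<nu> :: "('e \<times> 'x) measure"
  assumes irreducible: "irreducible_chain P"
    and recurrent: "positive_recurrent_chain P"
    and \<pi>: "stationary_distribution P \<pi>"
    and \<nu>: "\<nu> \<in> action_stationary X act g P"
begin

lemma action_stationary_iff:
  "N \<in> action_stationary X act g P \<longleftrightarrow> prob_space N \<and> sets N = sets S \<and> invariant_family (slice N)"
proof -
  have "action_kernel X act g P = kernel"
    by (simp add: action_kernel_def kernel_def)
  then show ?thesis
    using stationary_iff_invariant_family[of N]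
    by (auto simp: action_stationary_def prob_measures_on_def action_space_def)
qed

lemma prob_\<nu>: "prob_space \<nu>" and sets_\<nu>: "sets \<nu> = sets S" and invariant_slice: "invariant_family (slice \<nu>)"
  using \<nu> by (auto simp: action_stationary_iff)

lemma space_S: "space S = UNIV \<times> topspace X"
  by (simp add: space_pair_measure)

lemma finite_slice: "emeasure (slice \<nu> f) (space (borel_of X)) \<noteq> \<infinity>"
proof -
  interpret prob_space \<nu> by (rule prob_\<nu>)
  show ?thesis
    using emeasure_slice[OF sets_\<nu> sets.top, of f] by (simp del: space_borel_of)
qed

lemmas mass = excursion_mass_return[OF recurrent]

lemmas paths = irreducible_chain_path[OF irreducible]

lemma \<pi>_eq_excursion_mass: "ennreal (pmf \<pi> f) = ennreal (pmf \<pi> e) * excursion_mass P e f"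
  by (rule invariant_eq_excursion_mass[where a = "\<lambda>f. ennreal (pmf \<pi> f)",
        OF stationary_distribution_invariant[OF \<pi>] _ mass paths]) simp

lemma sum_\<pi>: "(\<integral>\<^sup>+f. ennreal (pmf \<pi> f) \<partial>count_space UNIV) = 1"
  by (rule nn_integral_pmf_eq_1)

text \<open>The slice masses and \<pi> are both multiples of the excursion mass from
  \<open>e\<close>, with factors their values at \<open>e\<close>. Both sum to 1, so each factor is
  the inverse of \<open>?H\<close>, the expected return time.\<close>

lemma slice_mass: "emeasure (slice \<nu> e) (space (borel_of X)) = ennreal (pmf \<pi> e)"
  and \<pi>_nonzero: "ennreal (pmf \<pi> e) \<noteq> 0"
proof -
  interpret prob_space \<nu> by (rule prob_\<nu>)
  let ?m = "\<lambda>f. emeasure (slice \<nu> f) (space (borel_of X))"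
  let ?H = "\<integral>\<^sup>+f. excursion_mass P e f \<partial>count_space UNIV"
  have "space \<nu> = space S"
    by (rule sets_eq_imp_space_eq[OF sets_\<nu>])
  moreover have "Pair f -` space S = space (borel_of X)" for f
    by (auto simp: space_S)
  ultimately have "1 = (\<integral>\<^sup>+f. ?m f \<partial>count_space UNIV)"
    using emeasure_eq_sum_slices[OF sets_\<nu> sets.top] emeasure_space_1 by simp
  also have "\<dots> = (\<integral>\<^sup>+f. ?m e * excursion_mass P e f \<partial>count_space UNIV)"
    by (rule nn_integral_cong, rule invariant_family_mass[OF invariant_slice finite_slice mass paths])
  also have "\<dots> = ?m e * ?H"
    by (rule nn_integral_cmult) simp
  finally have 1: "?m e * ?H = 1" by simp
  have "1 = (\<integral>\<^sup>+f. ennreal (pmf \<pi> e) * excursion_mass P e f \<partial>count_space UNIV)"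
    unfolding \<pi>_eq_excursion_mass[symmetric] by (rule sum_\<pi>[symmetric])
  also have "\<dots> = ennreal (pmf \<pi> e) * ?H"
    by (rule nn_integral_cmult) simp
  finally have 2: "ennreal (pmf \<pi> e) * ?H = 1" by simp
  \<comment> \<open>An infinite \<open>?H\<close> would make each product 0 or infinite; being
    finite and nonzero, it may be cancelled.\<close>
  have "?H \<noteq> 0" "?H \<noteq> \<top>"
    using 1 2 by (auto simp: ennreal_mult_eq_top_iff ennreal_top_mult ennreal_mult_top split: if_splits)
  then show "?m e = ennreal (pmf \<pi> e)"
    using 1 2 by (metis ennreal_mult_cancel_left mult.commute)
  show "ennreal (pmf \<pi> e) \<noteq> 0"
    using 2 by auto
qed

text \<open>The measure \<nu>_e of the theorem: the law of the point under \<nu>, conditioned on the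
  state \<open>e\<close>. The factor is finite by \<open>\<pi>_nonzero\<close>.\<close>

definition conditional :: "'e \<Rightarrow> 'x measure" where
  "conditional e = scale_measure (1 / ennreal (pmf \<pi> e)) (slice \<nu> e)"

lemma sets_conditional [simp]: "sets (conditional e) = sets (borel_of X)"
  by (simp add: conditional_def)

lemma \<pi>_cancel: "ennreal (pmf \<pi> e) * (1 / ennreal (pmf \<pi> e)) = 1"
  using \<pi>_nonzero[of e] by (simp add: ennreal_times_divide)

lemma emeasure_conditional: "ennreal (pmf \<pi> e) * emeasure (conditional e) A = emeasure (slice \<nu> e) A"
proof -
  have "ennreal (pmf \<pi> e) * emeasure (conditional e) A =
      (ennreal (pmf \<pi> e) * (1 / ennreal (pmf \<pi> e))) * emeasure (slice \<nu> e) A"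
    by (simp add: conditional_def mult.assoc del: ennreal_times_divide)
  then show ?thesis
    by (simp only: \<pi>_cancel mult_1_left)
qed

lemma prob_conditional: "prob_space (conditional e)"
proof
  have "space (conditional e) = space (borel_of X)"
    by (rule sets_eq_imp_space_eq) simp
  then have "emeasure (conditional e) (space (conditional e)) =
      1 / ennreal (pmf \<pi> e) * emeasure (slice \<nu> e) (space (borel_of X))"
    by (simp add: conditional_def)
  then show "emeasure (conditional e) (space (conditional e)) = 1"
    unfolding slice_mass using \<pi>_cancel by (simp only: mult.commute)
qed

lemma conditional_stationary: "conditional e \<in> mu_stationary X act (\<mu> e)"
proof -
  let ?c = "1 / ennreal (pmf \<pi> e)"
  have "excursion_measure e (conditional e) e = conditional e"
  proof (rule measure_eqI)
    fix A assume "A \<in> sets (excursion_measure e (conditional e) e)"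
    then have A: "A \<in> sets (borel_of X)" by simp
    \<comment> \<open>Linearity with second coefficient 0 is homogeneity; it reduces the fixed-point
      equation to the one for the slice.\<close>
    have "emeasure (excursion_measure e (conditional e) e) A =
        ?c * emeasure (excursion_measure e (slice \<nu> e) e) A + 0 * emeasure (excursion_measure e (slice \<nu> e) e) A"
      by (rule excursion_measure_linear) (use A in \<open>auto simp: conditional_def\<close>)
    also have "\<dots> = emeasure (conditional e) A"
      unfolding invariant_family_eq_excursion_measure[OF invariant_slice finite_slice mass paths]
      by (simp add: conditional_def)
    finally show "emeasure (excursion_measure e (conditional e) e) A = emeasure (conditional e) A" .
  qed simp
  then show ?thesis
    using prob_conditional by (simp add: mu_stationary_iff[OF recurrent])
qed

lemma decomposition:
  assumes A: "A \<in> sets (action_space X)"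
  shows "emeasure \<nu> A = (\<Sum>\<^sub>\<infinity>e. ennreal (pmf \<pi> e) *
    emeasure (return (count_space UNIV) e \<Otimes>\<^sub>M conditional e) A)"
proof -
  have AS: "A \<in> sets S"
    using A by (simp add: action_space_def)
  have "emeasure (return (count_space UNIV) e \<Otimes>\<^sub>M conditional e) A = emeasure (conditional e) (Pair e -` A)" for e
  proof -
    interpret prob_space "conditional e" by (rule prob_conditional)
    have "A \<in> sets (return (count_space UNIV) e \<Otimes>\<^sub>M conditional e)"
      using AS sets_pair_measure_cong[of "return (count_space UNIV) e" "count_space UNIV"
          "conditional e" "borel_of X"] by simp
    then have "emeasure (return (count_space UNIV) e \<Otimes>\<^sub>M conditional e) A =
        (\<integral>\<^sup>+f. emeasure (conditional e) (Pair f -` A) \<partial>return (count_space UNIV) e)"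
      by (rule emeasure_pair_measure_alt)
    also have "\<dots> = emeasure (conditional e) (Pair e -` A)"
      by (rule nn_integral_return) auto
    finally show ?thesis .
  qed
  then show ?thesis
    by (simp add: infsum_ennreal_eq_nn_integral emeasure_conditional emeasure_eq_sum_slices[OF sets_\<nu> AS])
qed

lemma conditional_transition:
  assumes A: "A \<in> sets (borel_of X)"
  shows "ennreal (pmf \<pi> e) * emeasure (conditional e) A =
    (\<Sum>\<^sub>\<infinity>e'. ennreal (pmf \<pi> e') * ennreal (pmf (P e') e) *
       emeasure (pushforward X act (g e') (conditional e')) A)"
proof -
  have "ennreal (pmf \<pi> a) * ennreal (pmf (P a) e) * emeasure (pushforward X act (g a) (conditional a)) A =
      ennreal (pmf (P a) e) * emeasure (slice \<nu> a) (pull a A)" for a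
    using A emeasure_conditional[of a "pull a A", symmetric]
    by (simp add: pushforward_def emeasure_distr_t mult_ac)
  then show ?thesis
    unfolding emeasure_conditional infsum_ennreal_eq_nn_integral
    using invariant_familyD(2)[OF invariant_slice A, of e] by simp
qed

section \<open>Absolute continuity and measure classes\<close>

lemma conditional_null_path:
  assumes A: "A \<in> sets (borel_of X)" and null: "emeasure (conditional e) A = 0"
    and w: "path_to P e w" "w \<noteq> []"
  shows "emeasure (pushforward X act (word_prod G g w) (conditional (last w))) A = 0"
proof -
  have "emeasure (slice \<nu> e) A = 0"
    using null by (simp flip: emeasure_conditional)
  then have "emeasure (distr (slice \<nu> (last w)) (borel_of X) (word_map (\<lambda>a. act (g a)) w)) A = 0"
    using invariant_family_null_path[OF invariant_slice A _ w] by simp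
  then show ?thesis
    using A by (simp add: pushforward_word_prod emeasure_distr_word_map conditional_def)
qed

lemma conditional_absolutely_continuous:
  assumes "path_to P e w" "w \<noteq> []"
  shows "absolutely_continuous (conditional e) (pushforward X act (word_prod G g w) (conditional (last w)))"
  unfolding absolutely_continuous_def
proof
  fix A assume "A \<in> null_sets (conditional e)"
  then show "A \<in> null_sets (pushforward X act (word_prod G g w) (conditional (last w)))"
    using conditional_null_path[OF _ _ assms, of A] by (auto simp: null_sets_def pushforward_def)
qed

lemma conditional_same_measure_class:
  assumes w: "path_to P e w" "w \<noteq> []"
    and inv: "invariant_under X act (renewal_semigroup G T g P e) (conditional e)"
  shows "same_measure_class (conditional e) (pushforward X act (word_prod G g w) (conditional (last w)))"
  unfolding same_measure_class_def
proof
  show "absolutely_continuous (conditional e) (pushforward X act (word_prod G g w) (conditional (last w)))"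
    by (rule conditional_absolutely_continuous[OF w])
  let ?f = "last w"
  let ?t = "word_map (\<lambda>a. act (g a))"
  \<comment> \<open>By irreducibility a path \<open>v\<close> starts in \<open>e\<close> and enters
    \<open>last w\<close>. Followed by \<open>w\<close> it closes up to the loop
    \<open>w @ v\<close> at \<open>e\<close>, as later letters stand on the left.\<close>
  obtain v where v: "v \<noteq> []" "last v = e" "path_to P ?f v"
    using paths[of e ?f] by auto
  have "path_to P e (w @ v)" "w @ v \<noteq> []" "last (w @ v) = e"
    using w v by (auto simp: path_to_append)
  then have "word_prod G g (w @ v) \<in> renewal_semigroup G T g P e"
    by (rule loop_in_renewal_semigroup[OF recurrent])
  then have fixed: "pushforward X act (word_prod G g (w @ v)) (conditional e) = conditional e"
    using inv by (simp add: invariant_under_def)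
  show "absolutely_continuous (pushforward X act (word_prod G g w) (conditional ?f)) (conditional e)"
    unfolding absolutely_continuous_def
  proof
    fix A assume "A \<in> null_sets (pushforward X act (word_prod G g w) (conditional ?f))"
    then have A: "A \<in> sets (borel_of X)"
      and "emeasure (distr (conditional ?f) (borel_of X) (?t w)) A = 0"
      by (auto simp: null_sets_def pushforward_def[of _ _ _ "conditional ?f"]
          simp flip: pushforward_word_prod[OF sets_conditional])
    then have "emeasure (conditional ?f) (pull_word pull w A) = 0"
      by (simp add: emeasure_distr_word_map)
    \<comment> \<open>Nullity at \<open>last w\<close> passes along \<open>v\<close> to nullity at
      \<open>e\<close>. So \<open>A\<close> is null for the push-forward along the whole loop, which
      is \<open>conditional e\<close> by invariance.\<close>
    then have "emeasure (pushforward X act (word_prod G g v) (conditional e)) (pull_word pull w A) = 0"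
      using conditional_null_path[OF _ _ v(3,1)] v(2) A by simp
    moreover have "emeasure (pushforward X act (word_prod G g v) (conditional e)) (pull_word pull w A) =
        emeasure (conditional e) (pull_word pull v (pull_word pull w A))"
      using A by (simp add: pushforward_word_prod emeasure_distr_word_map)
    moreover have "pull_word pull v (pull_word pull w A) = pull_word pull (w @ v) A"
      by (induction w arbitrary: A) auto
    moreover have "emeasure (conditional e) (pull_word pull (w @ v) A) =
        emeasure (pushforward X act (word_prod G g (w @ v)) (conditional e)) A"
      using A by (simp only: pushforward_word_prod[OF sets_conditional]
          emeasure_distr_word_map[OF sets_conditional])
    ultimately have "emeasure (conditional e) A = 0"
      unfolding fixed by simp
    then show "A \<in> null_sets (conditional e)"
      using A by (simp add: null_sets_def)
  qed
qed

section \<open>Ergodicity\<close>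

definition induced :: "'e \<Rightarrow> 'x measure \<Rightarrow> ('e \<times> 'x) measure" where
  "induced e \<eta> = assemble (\<lambda>_. ennreal (pmf \<pi> e)) (excursion_measure e \<eta>)"

text \<open>The excursion measure at \<open>f\<close> has mass \<open>excursion_mass P e f\<close>,
  which the constant weight \<open>pmf \<pi> e\<close> turns into \<open>pmf \<pi> f\<close>; so the
  total is 1. The second claim recovers \<eta> from the slice at \<open>e\<close>.\<close>

lemma induced_stationary:
  assumes "\<eta> \<in> mu_stationary X act (\<mu> e)"
  shows "induced e \<eta> \<in> action_stationary X act g P"
    and "A \<in> sets (borel_of X) \<Longrightarrow> emeasure (slice (induced e \<eta>) e) A = ennreal (pmf \<pi> e) * emeasure \<eta> A"
proof -
  have \<eta>: "prob_space \<eta>" "sets \<eta> = sets (borel_of X)" "excursion_measure e \<eta> e = \<eta>"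
    using assms by (auto simp: mu_stationary_iff[OF recurrent])
  interpret prob_space \<eta> by (rule \<eta>)
  have sp: "emeasure \<eta> (space (borel_of X)) = 1"
    using emeasure_space_1 sets_eq_imp_space_eq[OF \<eta>(2)] by simp
  have slice: "emeasure (slice (induced e \<eta>) f) A = ennreal (pmf \<pi> e) * emeasure (excursion_measure e \<eta> f) A"
    if "A \<in> sets (borel_of X)" for f A
    unfolding induced_def using that by (simp add: emeasure_slice_assemble)
  then show "emeasure (slice (induced e \<eta>) e) A = ennreal (pmf \<pi> e) * emeasure \<eta> A"
    if "A \<in> sets (borel_of X)"
    using that \<eta>(3) by simp
  have sets: "sets (induced e \<eta>) = sets S"
    by (simp add: induced_def)
  have "invariant_family (slice (induced e \<eta>))"
    by (rule invariant_family_scale[OF invariant_family_excursion_measure[OF \<eta>(2,3)] sets_slice slice])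
  moreover have "prob_space (induced e \<eta>)"
  proof
    have "Pair f -` space S = space (borel_of X)" for f
      by (auto simp: space_S)
    then have "emeasure (induced e \<eta>) (space S) =
        (\<integral>\<^sup>+f. ennreal (pmf \<pi> e) * emeasure (excursion_measure e \<eta> f) (space (borel_of X)) \<partial>count_space UNIV)"
      unfolding induced_def by (subst emeasure_assemble) simp_all
    also have "\<dots> = (\<integral>\<^sup>+f. ennreal (pmf \<pi> f) \<partial>count_space UNIV)"
      unfolding emeasure_excursion_measure_space[OF \<eta>(2)] sp mult_1_left
        \<pi>_eq_excursion_mass[symmetric] ..
    finally show "emeasure (induced e \<eta>) (space (induced e \<eta>)) = 1"
      unfolding sets_eq_imp_space_eq[OF sets] sum_\<pi> .
  qed
  ultimately show "induced e \<eta> \<in> action_stationary X act g P"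
    using sets by (simp add: action_stationary_iff)
qed

text \<open>A decomposition of \<open>conditional e\<close> lifts to one of \<nu> with the same
  weights. Extremality of \<nu> makes both induced measures equal to \<nu>, and comparing slices at
  \<open>e\<close> gives back the two components.\<close>

lemma conditional_ergodic:
  assumes erg: "action_ergodic X act g P \<nu>"
  shows "mu_ergodic X act (\<mu> e) (conditional e)"
  unfolding mu_ergodic_def extremal_in_def
proof (intro conjI ballI allI impI)
  show "conditional e \<in> mu_stationary X act (\<mu> e)"
    by (rule conditional_stationary)
  fix \<eta>1 \<eta>2 and s :: real
  assume \<eta>1: "\<eta>1 \<in> mu_stationary X act (\<mu> e)" and \<eta>2: "\<eta>2 \<in> mu_stationary X act (\<mu> e)"
    and "0 < s \<and> s < 1 \<and> (\<forall>A\<in>sets (conditional e).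
      measure (conditional e) A = s * measure \<eta>1 A + (1 - s) * measure \<eta>2 A)"
  then have s: "0 < s" "s < 1" and convex: "\<And>A. A \<in> sets (borel_of X) \<Longrightarrow>
      measure (conditional e) A = s * measure \<eta>1 A + (1 - s) * measure \<eta>2 A"
    by auto
  have sets: "sets \<eta>1 = sets (borel_of X)" "sets \<eta>2 = sets (borel_of X)"
    and prob: "prob_space \<eta>1" "prob_space \<eta>2"
    using \<eta>1 \<eta>2 by (auto simp: mu_stationary_iff[OF recurrent])
  note N = induced_stationary(1)[OF \<eta>1] induced_stationary(1)[OF \<eta>2]
  have probN: "prob_space (induced e \<eta>1)" "prob_space (induced e \<eta>2)"
    using N by (auto simp: action_stationary_iff)
  interpret C: prob_space "conditional e" by (rule prob_conditional)
  interpret E1: prob_space \<eta>1 by (rule prob)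
  interpret E2: prob_space \<eta>2 by (rule prob)
  interpret N1: prob_space "induced e \<eta>1" by (rule probN)
  interpret N2: prob_space "induced e \<eta>2" by (rule probN)
  interpret V: prob_space \<nu> by (rule prob_\<nu>)
  let ?p = "ennreal (pmf \<pi> e)"
  have cond: "emeasure (slice \<nu> e) A = (?p * ennreal s) * emeasure \<eta>1 A + (?p * ennreal (1 - s)) * emeasure \<eta>2 A"
    if A: "A \<in> sets (borel_of X)" for A
  proof -
    have "emeasure (conditional e) A = ennreal s * emeasure \<eta>1 A + ennreal (1 - s) * emeasure \<eta>2 A"
      using s convex[OF A]
      by (simp add: C.emeasure_eq_measure E1.emeasure_eq_measure E2.emeasure_eq_measure
          ennreal_mult ennreal_plus)
    then show ?thesis
      by (simp add: emeasure_conditional[symmetric] distrib_left mult.assoc)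
  qed
  have mix: "measure \<nu> A = s * measure (induced e \<eta>1) A + (1 - s) * measure (induced e \<eta>2) A"
    if "A \<in> sets \<nu>" for A
  proof -
    have A: "A \<in> sets S"
      using that by (simp add: sets_\<nu>)
    \<comment> \<open>Every slice of \<nu> is the excursion measure of its slice at
      \<open>e\<close>, so the decomposition at \<open>e\<close> propagates linearly to all
      states.\<close>
    have "emeasure \<nu> A = (\<integral>\<^sup>+f. emeasure (excursion_measure e (slice \<nu> e) f) (Pair f -` A) \<partial>count_space UNIV)"
      unfolding emeasure_eq_sum_slices[OF sets_\<nu> A]
        invariant_family_eq_excursion_measure[OF invariant_slice finite_slice mass paths] ..
    also have "\<dots> = (\<integral>\<^sup>+f. (?p * ennreal s) * emeasure (excursion_measure e \<eta>1 f) (Pair f -` A) +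
        (?p * ennreal (1 - s)) * emeasure (excursion_measure e \<eta>2 f) (Pair f -` A) \<partial>count_space UNIV)"
      by (intro nn_integral_cong excursion_measure_linear[OF sets_slice sets cond] sets_section[OF A])
    also have "\<dots> = ennreal s * (\<integral>\<^sup>+f. ?p * emeasure (excursion_measure e \<eta>1 f) (Pair f -` A) \<partial>count_space UNIV) +
        ennreal (1 - s) * (\<integral>\<^sup>+f. ?p * emeasure (excursion_measure e \<eta>2 f) (Pair f -` A) \<partial>count_space UNIV)"
      by (simp add: nn_integral_add nn_integral_cmult mult_ac)
    also have "\<dots> = ennreal s * emeasure (induced e \<eta>1) A + ennreal (1 - s) * emeasure (induced e \<eta>2) A"
      unfolding induced_def by (simp add: emeasure_assemble[OF sets_excursion_measure A])
    finally have "ennreal (measure \<nu> A) =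
        ennreal (s * measure (induced e \<eta>1) A + (1 - s) * measure (induced e \<eta>2) A)"
      using s by (simp add: V.emeasure_eq_measure N1.emeasure_eq_measure N2.emeasure_eq_measure
          ennreal_mult ennreal_plus)
    then show ?thesis
      using s by (subst (asm) ennreal_inj) auto
  qed
  have eq: "induced e \<eta>1 = \<nu>" "induced e \<eta>2 = \<nu>"
    using erg N s mix unfolding action_ergodic_def extremal_in_def by blast+
  have "\<eta> = conditional e" if \<eta>: "\<eta> \<in> mu_stationary X act (\<mu> e)" "induced e \<eta> = \<nu>" for \<eta>
  proof (rule measure_eqI)
    show sets_\<eta>: "sets \<eta> = sets (conditional e)"
      using \<eta> by (simp add: mu_stationary_iff[OF recurrent])
    fix A assume "A \<in> sets \<eta>"
    then have "?p * emeasure \<eta> A = ?p * emeasure (conditional e) A"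
      using induced_stationary(2)[OF \<eta>(1), of A] sets_\<eta> \<eta>(2) by (simp add: emeasure_conditional)
    then show "emeasure \<eta> A = emeasure (conditional e) A"
      using \<pi>_nonzero[of e] by (simp add: ennreal_mult_cancel_left)
  qed
  then show "\<eta>1 = conditional e" "\<eta>2 = conditional e"
    using \<eta>1 \<eta>2 eq by blast+
qed

end

theorem lemma3p7:
  fixes G :: "('g, 'm) monoid_scheme" and T :: "'g topology"
    and n :: nat and \<A> :: "('g set \<times> ('g \<Rightarrow> nat \<Rightarrow> real)) set"
    and X :: "'x topology" and act :: "'g \<Rightarrow> 'x \<Rightarrow> 'x"
    and g :: "'e::countable \<Rightarrow> 'g" and P :: "'e \<Rightarrow> 'e pmf" and \<pi> :: "'e pmf"
    and \<nu> :: "('e \<times> 'x) measure"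
  assumes "real_Lie_group G T n \<A>"
    and "locally_compact_space X" and "second_countable X" and "metrizable_space X"
    and "continuous_group_action G T X act"
    and "\<And>e. g e \<in> carrier G"
    and "irreducible_chain P" and "positive_recurrent_chain P"
    and "stationary_distribution P \<pi>"
    and "\<nu> \<in> action_stationary X act g P"
  shows "\<exists>\<nu>' :: 'e \<Rightarrow> 'x measure.
    (\<forall>A\<in>sets (action_space X).
       emeasure \<nu> A =
         (\<Sum>\<^sub>\<infinity>e. ennreal (pmf \<pi> e) * emeasure (return (count_space UNIV) e \<Otimes>\<^sub>M \<nu>' e) A)) \<and>
    (\<forall>e. \<nu>' e \<in> mu_stationary X act (renewal_measure G T g P e)) \<and>
    (\<forall>e. \<forall>A\<in>sets (borel_of X).
       ennreal (pmf \<pi> e) * emeasure (\<nu>' e) A =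
         (\<Sum>\<^sub>\<infinity>e'. ennreal (pmf \<pi> e') * ennreal (pmf (P e') e) *
                   emeasure (pushforward X act (g e') (\<nu>' e')) A)) \<and>
    (action_ergodic X act g P \<nu> \<longrightarrow>
       (\<forall>e. mu_ergodic X act (renewal_measure G T g P e) (\<nu>' e))) \<and>
    (\<forall>e e' c. admissible P e e' c \<longrightarrow>
       absolutely_continuous (\<nu>' e) (pushforward X act (word_prod G g c) (\<nu>' e')) \<and>
       (invariant_under X act (renewal_semigroup G T g P e) (\<nu>' e) \<longrightarrow>
          same_measure_class (\<nu>' e) (pushforward X act (word_prod G g c) (\<nu>' e'))))"
proof -
  interpret Lie: real_Lie_group G T n \<A>
    by (rule assms)
  interpret stationary_action_chain G T X act g P \<pi> \<nu>
    by unfold_locales (use assms Lie.topspace_eq Lie.Hausdorff in auto)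
  \<comment> \<open>The witness is \<open>conditional\<close>. An admissible word is a non-empty
    path whose last list entry is e', the form in which the measure-class lemmas are stated.\<close>
  show ?thesis
    by (rule exI[of _ conditional])
       (auto simp: decomposition conditional_stationary conditional_transition conditional_ergodic
          admissible_iff_path_to conditional_absolutely_continuous conditional_same_measure_class)
qed

end
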